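(* Let $G$ be an infinite discrete countable group and let $(X,G)$ be a tame minimal $G$-system. Let $(H,G)$ be the maximal equicontinuous factor of $(X,G)$ with factor map $\pi:X\to H$, and let $\nu$ be the Haar measure on $H$. Assume $K\in\mathbb{N}$ and $\pi$ is almost $K$ to one. Then $\nu(\{h\in H:|\pi^{-1}(h)|=K\})=1$.
   Context: A $G$-system $(X,G)$ is a compact metric space on which $G$ acts by homeomorphisms; minimal means every orbit is dense. The enveloping (Ellis) semigroup $E(X)$ is the closure of $\{x\mapsto gx: g\in G\}$ in $X^X$ with the product topology; $(X,G)$ is tame if $E(X)$ is separable and Fréchet. The maximal equicontinuous factor $(H,G)$ is $X/S_{eq}$, where $S_{eq}$ is the smallest closed $G$-invariant equivalence relation on $X$ whose quotient system is equicontinuous, and $\pi$ is the quotient map; $\nu$ is the unique $G$-invariant Borel probability measure on $H$ (the Haar measure). A factor map $\pi:X\to H$ is almost $K$ to one if the set $\{h\in H:|\pi^{-1}(h)|=K\}$ is residual (contains a dense $G_\delta$) in $H$. *)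

theory Defs
  imports "HOL-Analysis.Analysis" "HOL-Probability.Probability"
begin

text \<open>A G-system: G a (discrete) group, written additively via the type class group_add
  (not necessarily commutative), acting on a compact metric space X by homeomorphisms.\<close>
definition G_system :: "('g::group_add \<Rightarrow> 'x::metric_space \<Rightarrow> 'x) \<Rightarrow> 'x set \<Rightarrow> bool" where
  "G_system act X \<longleftrightarrow> compact X \<and>
     (\<forall>x\<in>X. act 0 x = x) \<and>
     (\<forall>g h. \<forall>x\<in>X. act (g + h) x = act g (act h x)) \<and>
     (\<forall>g. continuous_on X (act g) \<and> act g ` X \<subseteq> X)"

definition minimal_system :: "('g::group_add \<Rightarrow> 'x::metric_space \<Rightarrow> 'x) \<Rightarrow> 'x set \<Rightarrow> bool" where
  "minimal_system act X \<longleftrightarrow> (\<forall>x\<in>X. X \<subseteq> closure (range (\<lambda>g. act g x)))"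

definition pointwise_top :: "'x::metric_space set \<Rightarrow> ('x \<Rightarrow> 'x) topology" where
  "pointwise_top X = product_topology (\<lambda>_. top_of_set X) X"

definition enveloping_semigroup :: "('g::group_add \<Rightarrow> 'x::metric_space \<Rightarrow> 'x) \<Rightarrow> 'x set \<Rightarrow> ('x \<Rightarrow> 'x) set" where
  "enveloping_semigroup act X = (pointwise_top X) closure_of {restrict (act g) X | g. True}"

definition frechet_space :: "'a topology \<Rightarrow> bool" where
  "frechet_space T \<longleftrightarrow> (\<forall>A p. A \<subseteq> topspace T \<and> p \<in> T closure_of A \<longrightarrow>
       (\<exists>s::nat \<Rightarrow> 'a. range s \<subseteq> A \<and> limitin T s p sequentially))"

definition tame_system :: "('g::group_add \<Rightarrow> 'x::metric_space \<Rightarrow> 'x) \<Rightarrow> 'x set \<Rightarrow> bool" where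
  "tame_system act X \<longleftrightarrow>
     separable_space (subtopology (pointwise_top X) (enveloping_semigroup act X)) \<and>
     frechet_space (subtopology (pointwise_top X) (enveloping_semigroup act X))"

text \<open>A closed G-invariant equivalence relation R on X whose quotient system X/R is
  equicontinuous. The quotient X/R is the set of classes X//R carrying the quotient topology;
  it is equicontinuous if it carries a metric inducing the quotient topology with respect
  to which the induced maps C \<mapsto> g C are equicontinuous.\<close>
definition quotient_equicontinuous ::
  "('g::group_add \<Rightarrow> 'x::metric_space \<Rightarrow> 'x) \<Rightarrow> 'x set \<Rightarrow> ('x \<times> 'x) set \<Rightarrow> bool" where
  "quotient_equicontinuous act X R \<longleftrightarrow>
     (\<exists>d. Metric_space (X//R) d \<and>
        (\<forall>U. openin (Metric_space.mtopology (X//R) d) U \<longleftrightarrow>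
              U \<subseteq> X//R \<and> openin (top_of_set X) (\<Union>U)) \<and>
        (\<forall>e>0. \<exists>\<delta>>0. \<forall>g. \<forall>C\<in>X//R. \<forall>D\<in>X//R.
              d C D < \<delta> \<longrightarrow> d (act g ` C) (act g ` D) < e))"

definition eqc_relation ::
  "('g::group_add \<Rightarrow> 'x::metric_space \<Rightarrow> 'x) \<Rightarrow> 'x set \<Rightarrow> ('x \<times> 'x) set \<Rightarrow> bool" where
  "eqc_relation act X R \<longleftrightarrow> equiv X R \<and> closed R \<and>
     (\<forall>g x y. (x, y) \<in> R \<longrightarrow> (act g x, act g y) \<in> R) \<and>
     quotient_equicontinuous act X R"

definition is_S_eq ::
  "('g::group_add \<Rightarrow> 'x::metric_space \<Rightarrow> 'x) \<Rightarrow> 'x set \<Rightarrow> ('x \<times> 'x) set \<Rightarrow> bool" where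
  "is_S_eq act X S \<longleftrightarrow> eqc_relation act X S \<and> (\<forall>R. eqc_relation act X R \<longrightarrow> S \<subseteq> R)"

text \<open>pi : X \<rightarrow> H is (up to isomorphism) the quotient map X \<rightarrow> X/S_eq: a factor map
  of G-systems whose kernel relation is S_eq.\<close>
definition max_equicontinuous_factor ::
  "('g::group_add \<Rightarrow> 'x::metric_space \<Rightarrow> 'x) \<Rightarrow> 'x set \<Rightarrow>
   ('g \<Rightarrow> 'h::metric_space \<Rightarrow> 'h) \<Rightarrow> 'h set \<Rightarrow> ('x \<Rightarrow> 'h) \<Rightarrow> bool" where
  "max_equicontinuous_factor act X actH H \<pi> \<longleftrightarrow>
     G_system actH H \<and> continuous_on X \<pi> \<and> \<pi> ` X = H \<and>
     (\<forall>g. \<forall>x\<in>X. \<pi> (act g x) = actH g (\<pi> x)) \<and>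
     is_S_eq act X {(x, y). x \<in> X \<and> y \<in> X \<and> \<pi> x = \<pi> y}"

definition invariant_prob :: "('g \<Rightarrow> 'h::metric_space \<Rightarrow> 'h) \<Rightarrow> 'h set \<Rightarrow> 'h measure \<Rightarrow> bool" where
  "invariant_prob actH H \<mu> \<longleftrightarrow> prob_space \<mu> \<and> sets \<mu> = sets (restrict_space borel H) \<and>
     (\<forall>g. \<forall>A\<in>sets \<mu>. emeasure \<mu> (actH g -` A \<inter> H) = emeasure \<mu> A)"

definition haar_measure :: "('g \<Rightarrow> 'h::metric_space \<Rightarrow> 'h) \<Rightarrow> 'h set \<Rightarrow> 'h measure \<Rightarrow> bool" where
  "haar_measure actH H \<nu> \<longleftrightarrow> invariant_prob actH H \<nu> \<and>
     (\<forall>\<mu>. invariant_prob actH H \<mu> \<longrightarrow> \<mu> = \<nu>)"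

definition fiber_card_eq :: "'x set \<Rightarrow> ('x \<Rightarrow> 'h) \<Rightarrow> 'h \<Rightarrow> nat \<Rightarrow> bool" where
  "fiber_card_eq X \<pi> h K \<longleftrightarrow> finite {x\<in>X. \<pi> x = h} \<and> card {x\<in>X. \<pi> x = h} = K"

definition residual_in :: "'h::topological_space set \<Rightarrow> 'h set \<Rightarrow> bool" where
  "residual_in H S \<longleftrightarrow> (\<exists>D. D \<subseteq> S \<and> gdelta_in (top_of_set H) D \<and> H \<subseteq> closure D)"

definition almost_K_to_one :: "'x set \<Rightarrow> 'h::topological_space set \<Rightarrow> ('x \<Rightarrow> 'h) \<Rightarrow> nat \<Rightarrow> bool" where
  "almost_K_to_one X H \<pi> K \<longleftrightarrow> residual_in H {h\<in>H. fiber_card_eq X \<pi> h K}"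

end

theory Submission
  imports Defs
begin

text \<open>Suppose that the fibres with more than K points have positive Haar measure. Such a fibre over b
  has a point x that generic K-point fibres over points near b avoid. Since \<open>\<pi>\<close> maps open sets to
  sets with interior, there are a ball around x and two open sets \<open>O\<^sub>1\<close>, \<open>O\<^sub>0\<close> in H, over which all
  fibres meet the ball, respectively miss a larger ball, whose closures intersect in a set B of
  positive measure. As G acts equicontinuously on H, the mean value of continuous functions along
  orbits shows that finitely many points lying hierarchically close together can be moved into B
  simultaneously. This yields group elements \<open>g\<^sub>0, g\<^sub>1, \<dots>\<close> such that every pattern of \<open>O\<^sub>1\<close> and
  \<open>O\<^sub>0\<close> is realized by some point of H. Lifting to K-point fibres and passing to limits, every
  infinite 0-1-pattern is realized on a finite subset of X. Hence no subsequence of \<open>g\<^sub>n\<close> with distinct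
  indices converges pointwise on X, which contradicts the Frechet property of the enveloping semigroup.\<close>

section \<open>Minimal actions\<close>

text \<open>Positive measure of a closed set B returns one point to B, but several unrelated points
  need not return together. Keeping the points close to each other is what saves the argument. If an
  element \<xi> of the group closure moves p into B and q is close to p, then \<xi> q lies in a thin
  neighbourhood of B, so the failure of \<xi> q to be in B costs only the measure of a thin shell,
  whatever q is. Hence every point can be doubled while at least half of the previous lower bound
  survives. The radii e and 2e serve the passage to the limit: coming within e of q and staying 2e
  away from q are both closed conditions, and they exclude each other. A pattern speaks about a
  whole fibre: some point of it has to be moved near q, or all of its points away from q. Limits
  respect this because generic fibres have one common finite size K, so that they become K-tuples in
  a compact space. Fibres with fewer than K points are excluded everywhere, by Baire category and
  minimality, so only the larger ones require measure theory.\<close>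

locale minimal_G_system =
  fixes act :: "'g::group_add \<Rightarrow> 'x::metric_space \<Rightarrow> 'x" and X :: "'x set"
  assumes G_system: "G_system act X" and minimal: "minimal_system act X"
begin

lemma compact: "compact X"
  and act_zero: "x \<in> X \<Longrightarrow> act 0 x = x"
  and act_add: "x \<in> X \<Longrightarrow> act (g + h) x = act g (act h x)"
  and continuous_act: "continuous_on X (act g)"
  and act_in: "x \<in> X \<Longrightarrow> act g x \<in> X"
  using G_system unfolding G_system_def by (blast+)

lemma act_uminus_act: "x \<in> X \<Longrightarrow> act (- g) (act g x) = x"
  and act_act_uminus: "x \<in> X \<Longrightarrow> act g (act (- g) x) = x"
  by (metis act_add act_zero left_minus, metis act_add act_zero right_minus)

lemma visits_open:
  assumes "x \<in> X" "open U" "U \<inter> X \<noteq> {}"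
  obtains g where "act g x \<in> U"
proof -
  obtain y where "y \<in> U" "y \<in> closure (range (\<lambda>g. act g x))"
    using assms minimal unfolding minimal_system_def by blast
  then have "U \<inter> range (\<lambda>g. act g x) \<noteq> {}"
    using assms(2) by (metis disjoint_iff open_Int_closure_eq_empty)
  then show thesis
    using that by blast
qed

lemma openin_vimage_act:
  assumes "openin (top_of_set X) U"
  shows "openin (top_of_set X) {x \<in> X. act g x \<in> U}"
proof -
  have "openin (top_of_set X) (X \<inter> act g -` U)"
    using continuous_openin_preimage[OF continuous_act[of g] _ assms] act_in by blast
  then show ?thesis
    by (simp add: vimage_def Int_def)
qed

lemma closedin_vimage_act:
  assumes "closedin (top_of_set X) U"
  shows "closedin (top_of_set X) {x \<in> X. act g x \<in> U}"
proof -
  have "closedin (top_of_set X) (X \<inter> act g -` U)"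
    using continuous_closedin_preimage_gen[OF continuous_act[of g] _ assms] act_in by blast
  then show ?thesis
    by (simp add: vimage_def Int_def)
qed

lemma visits_openin:
  assumes "x \<in> X" "openin (top_of_set X) U" "U \<noteq> {}"
  obtains g where "act g x \<in> U"
proof -
  obtain V where V: "open V" "U = X \<inter> V"
    using assms(2) by (auto simp: openin_open)
  then obtain g where "act g x \<in> V"
    using visits_open[OF assms(1) V(1)] assms(3) by blast
  then show thesis
    using V(2) act_in[OF assms(1)] that by blast
qed

lemma openin_finite_pattern:
  fixes O' :: "bool \<Rightarrow> 'x set" and g :: "nat \<Rightarrow> 'g" and n :: nat
  assumes "\<And>b. openin (top_of_set X) (O' b)"
  shows "openin (top_of_set X) {x \<in> X. \<forall>i<n. act (g i) x \<in> O' (\<sigma> i)}"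
proof (induction n)
  case (Suc n)
  have "{x \<in> X. \<forall>i<Suc n. act (g i) x \<in> O' (\<sigma> i)} =
      {x \<in> X. \<forall>i<n. act (g i) x \<in> O' (\<sigma> i)} \<inter> {x \<in> X. act (g n) x \<in> O' (\<sigma> n)}"
    by (auto simp: less_Suc_eq)
  then show ?case
    using openin_Int[OF Suc openin_vimage_act[OF assms]] by simp
qed simp

text \<open>Group elements act as homeomorphisms: \<open>act g\<close> carries the interior of the
  preimage onto an open subset of U, written here as a preimage under \<open>act (- g)\<close>. This
  moves an interior point found by Baire category back to the untranslated set.\<close>

lemma interior_of_vimage_act:
  assumes "top_of_set X interior_of {x \<in> X. act g x \<in> U} \<noteq> {}"
  shows "top_of_set X interior_of U \<noteq> {}"
proof -
  let ?V = "top_of_set X interior_of {x \<in> X. act g x \<in> U}"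
  have op: "openin (top_of_set X) {x \<in> X. act (- g) x \<in> ?V}"
    by (intro openin_vimage_act openin_interior_of)
  have "?V \<subseteq> {x \<in> X. act g x \<in> U}"
    by (rule interior_of_subset)
  then have "{x \<in> X. act (- g) x \<in> ?V} \<subseteq> U"
    using act_act_uminus by fastforce
  then have "{x \<in> X. act (- g) x \<in> ?V} \<subseteq> top_of_set X interior_of U"
    using op by (simp add: interior_of_maximal)
  moreover obtain y where y: "y \<in> ?V"
    using assms by blast
  then have "y \<in> X"
    using interior_of_subset_topspace[of "top_of_set X"] by auto
  then have "act g y \<in> {x \<in> X. act (- g) x \<in> ?V}"
    using y by (simp add: act_in act_uminus_act)
  ultimately show ?thesis
    by blast
qed

lemma Baire:
  assumes "countable \<G>" "\<And>T. T \<in> \<G> \<Longrightarrow> closedin (top_of_set X) T" "X \<subseteq> \<Union>\<G>" "X \<noteq> {}"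
  obtains T where "T \<in> \<G>" "top_of_set X interior_of T \<noteq> {}"
proof -
  have "locally_compact_space (top_of_set X) \<and> regular_space (top_of_set X)"
    using compact by (simp add: compact_imp_locally_compact_space compact_space_subtopology
        metrizable_imp_regular_space metrizable_space_subtopology metrizable_space_euclidean)
  moreover have "top_of_set X interior_of \<Union>\<G> = X"
  proof -
    have "\<Union>\<G> \<subseteq> X"
      using assms(2) closedin_subset by force
    then have "\<Union>\<G> = topspace (top_of_set X)"
      using assms(3) by auto
    then show ?thesis
      by (metis interior_of_topspace topspace_euclidean_subtopology)
  qed
  ultimately show thesis
    using Baire_category_alt[of "top_of_set X" \<G>] assms that by blast
qed

end

section \<open>Mean values along orbits\<close>

text \<open>Averaging over a finite list of group elements stands in for Haar measure on the compact
  group closure of G.\<close>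

definition list_avg :: "('g \<Rightarrow> 'x \<Rightarrow> 'x) \<Rightarrow> 'g list \<Rightarrow> ('x \<Rightarrow> real) \<Rightarrow> 'x \<Rightarrow> real" where
  "list_avg act L f x = (\<Sum>g\<leftarrow>L. f (act g x)) / length L"

lemma sum_list_ge_const:
  fixes f :: "'a \<Rightarrow> real" and c :: real
  assumes "\<And>x. x \<in> set L \<Longrightarrow> f x \<ge> c"
  shows "(\<Sum>x\<leftarrow>L. f x) \<ge> length L * c"
  using assms by (induction L) (force simp: algebra_simps)+

lemma sum_list_le_const:
  fixes f :: "'a \<Rightarrow> real" and c :: real
  assumes "\<And>x. x \<in> set L \<Longrightarrow> f x \<le> c"
  shows "(\<Sum>x\<leftarrow>L. f x) \<le> length L * c"
  using assms by (induction L) (force simp: algebra_simps)+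

lemma list_avg_ge:
  assumes "L \<noteq> []" "\<And>g. g \<in> set L \<Longrightarrow> f (act g x) \<ge> c"
  shows "list_avg act L f x \<ge> c"
  using sum_list_ge_const[of L c "\<lambda>g. f (act g x)"] assms
  by (simp add: list_avg_def field_simps)

lemma list_avg_le:
  assumes "L \<noteq> []" "\<And>g. g \<in> set L \<Longrightarrow> f (act g x) \<le> c"
  shows "list_avg act L f x \<le> c"
  using sum_list_le_const[of L "\<lambda>g. f (act g x)" c] assms
  by (simp add: list_avg_def field_simps)

text \<open>A single good translate among k raises a uniform lower bound by the fraction 1/k of the
  gap. This gain makes iterated averaging improve strictly.\<close>

lemma list_avg_ge_one_good:
  assumes L: "length L = k" "L \<noteq> []" and ge: "\<And>g. g \<in> set L \<Longrightarrow> f (act g x) \<ge> c"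
    and g: "g \<in> set L" "f (act g x) \<ge> d"
  shows "list_avg act L f x \<ge> c + (d - c) / k"
proof -
  obtain L1 L2 where split: "L = L1 @ g # L2"
    using g(1) by (meson split_list)
  have "(\<Sum>g\<leftarrow>L1. f (act g x)) \<ge> length L1 * c" "(\<Sum>g\<leftarrow>L2. f (act g x)) \<ge> length L2 * c"
    by (rule sum_list_ge_const, use ge split in auto)+
  then have *: "(\<Sum>g\<leftarrow>L. f (act g x)) \<ge> k * c + (d - c)"
    using g(2) L(1)[symmetric] unfolding split by (simp add: algebra_simps)
  have "real k > 0"
    using L by auto
  with * have "c + (d - c) / k \<le> (\<Sum>g\<leftarrow>L. f (act g x)) / k"
    using divide_right_mono[of "k * c + (d - c)" "\<Sum>g\<leftarrow>L. f (act g x)" k]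
    by (simp add: add_divide_distrib)
  then show ?thesis
    by (simp add: list_avg_def L(1))
qed

context minimal_G_system
begin

text \<open>Iterated averages are again averages, so the lists form a class closed under further
  averaging. The order \<open>h + g\<close> reflects that g acts first.\<close>

lemma list_avg_list_avg:
  assumes "x \<in> X"
  shows "list_avg act L (list_avg act M f) x
       = list_avg act (concat (map (\<lambda>g. map (\<lambda>h. h + g) M) L)) f x"
proof -
  have "(\<Sum>k\<leftarrow>concat (map (\<lambda>g. map (\<lambda>h. h + g) M) L). f (act k x))
      = (\<Sum>g\<leftarrow>L. \<Sum>h\<leftarrow>M. f (act h (act g x)))"
    using assms by (induction L) (auto simp: act_add o_def)
  moreover have "length (concat (map (\<lambda>g. map (\<lambda>h. h + g) M) L)) = length L * length M"
    by (induction L) auto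
  moreover have "(\<Sum>g\<leftarrow>L. (\<Sum>h\<leftarrow>M. f (act h (act g x))) / length M)
      = (\<Sum>g\<leftarrow>L. \<Sum>h\<leftarrow>M. f (act h (act g x))) / length M"
    by (induction L) (auto simp: add_divide_distrib)
  ultimately show ?thesis
    by (simp add: list_avg_def field_simps)
qed

lemma continuous_on_act_comp:
  "continuous_on X f \<Longrightarrow> continuous_on X (\<lambda>x. f (act g x))"
  by (rule continuous_on_compose2[OF _ continuous_act]) (auto simp: act_in)

lemma continuous_on_list_avg:
  assumes "continuous_on X f"
  shows "continuous_on X (list_avg act L f)"
proof -
  have "continuous_on X (\<lambda>x. \<Sum>g\<leftarrow>L. f (act g x))"
    by (induction L) (auto intro!: continuous_intros continuous_on_act_comp assms)
  then show ?thesis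
    unfolding list_avg_def divide_inverse by (intro continuous_intros)
qed

end

locale equicontinuous_G_system = minimal_G_system act X
  for act :: "'g::group_add \<Rightarrow> 'x::metric_space \<Rightarrow> 'x" and X :: "'x set" +
  fixes \<nu> :: "'x measure"
  assumes equicontinuous:
    "e > 0 \<Longrightarrow> \<exists>\<delta>>0. \<forall>g. \<forall>x\<in>X. \<forall>y\<in>X. dist x y < \<delta> \<longrightarrow> dist (act g x) (act g y) < e"
    and invariant: "invariant_prob act X \<nu>"
begin

sublocale prob_space \<nu>
  using invariant by (simp add: invariant_prob_def)

lemma sets_\<nu>: "sets \<nu> = sets (restrict_space borel X)"
  using invariant by (simp add: invariant_prob_def)

lemma space_\<nu>: "space \<nu> = X"
  using sets_eq_imp_space_eq[OF sets_\<nu>] by (simp add: space_restrict_space)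

lemma nonempty: "X \<noteq> {}"
  using not_empty space_\<nu> by simp

lemma sets_closedin: "closedin (top_of_set X) B \<Longrightarrow> B \<in> sets \<nu>"
  unfolding sets_\<nu> by (auto simp: closedin_closed sets_restrict_space)

lemma borel_measurable_continuous:
  fixes f :: "'x \<Rightarrow> 'c::topological_space"
  assumes "continuous_on X f"
  shows "f \<in> borel_measurable \<nu>"
  using borel_measurable_continuous_on_restrict[OF assms] measurable_cong_sets[OF sets_\<nu> refl] by blast

lemma integrable_continuous:
  fixes f :: "'x \<Rightarrow> real"
  assumes "continuous_on X f"
  shows "integrable \<nu> f"
proof -
  have "bounded (f ` X)"
    using assms compact compact_continuous_image compact_imp_bounded by blast
  then obtain B where "\<forall>x\<in>X. norm (f x) \<le> B"
    by (auto simp: bounded_iff)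
  then show ?thesis
    by (intro integrable_const_bound[where B=B] borel_measurable_continuous assms)
      (auto simp: space_\<nu>)
qed

lemma measurable_act: "act g \<in> \<nu> \<rightarrow>\<^sub>M \<nu>"
proof -
  have "act g \<in> \<nu> \<rightarrow>\<^sub>M restrict_space borel X"
    by (rule measurable_restrict_space2) (auto simp: space_\<nu> act_in borel_measurable_continuous continuous_act)
  then show ?thesis
    using measurable_cong_sets[OF refl sets_\<nu>] by blast
qed

lemma distr_act: "distr \<nu> \<nu> (act g) = \<nu>"
  by (rule measure_eqI)
    (use invariant in \<open>auto simp: emeasure_distr[OF measurable_act] invariant_prob_def space_\<nu>\<close>)

lemma integral_act:
  fixes f :: "'x \<Rightarrow> real"
  assumes "continuous_on X f"
  shows "(\<integral>x. f (act g x) \<partial>\<nu>) = (\<integral>x. f x \<partial>\<nu>)"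
proof -
  have "(\<integral>x. f x \<partial>distr \<nu> \<nu> (act g)) = (\<integral>x. f (act g x) \<partial>\<nu>)"
    by (rule integral_distr[OF measurable_act]) (rule borel_measurable_continuous[OF assms])
  then show ?thesis
    by (simp add: distr_act)
qed

lemma integral_list_avg:
  assumes "continuous_on X f" "L \<noteq> []"
  shows "(\<integral>x. list_avg act L f x \<partial>\<nu>) = (\<integral>x. f x \<partial>\<nu>)"
proof -
  have "integrable \<nu> (\<lambda>x. \<Sum>g\<leftarrow>L. f (act g x)) \<and>
      (\<integral>x. (\<Sum>g\<leftarrow>L. f (act g x)) \<partial>\<nu>) = length L * (\<integral>x. f x \<partial>\<nu>)"
    by (induction L)
      (auto simp: integral_act assms(1) continuous_on_act_comp integrable_continuous algebra_simps)
  then show ?thesis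
    using assms(2) by (simp add: list_avg_def)
qed

text \<open>The number k of translates needed does not depend on the target point.\<close>

lemma uniform_return:
  assumes "\<delta> > 0"
  obtains k where "k > 0"
    "\<And>y. y \<in> X \<Longrightarrow> \<exists>J. length J = k \<and> (\<forall>x\<in>X. \<exists>g\<in>set J. dist (act g x) y < \<delta>)"
proof -
  \<comment> \<open>A list is found once for a base point z. For another target y it is translated
    by some t taking z close to y; equicontinuity bounds the distortion for all t alike, so the
    length stays the same.\<close>
  obtain z where z: "z \<in> X"
    using nonempty by blast
  obtain \<delta>' where \<delta>': "\<delta>' > 0"
    "\<And>g x y. x \<in> X \<Longrightarrow> y \<in> X \<Longrightarrow> dist x y < \<delta>' \<Longrightarrow> dist (act g x) (act g y) < \<delta> / 2"
    using equicontinuous[of "\<delta> / 2"] assms by auto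
  have op: "openin (top_of_set X) {x \<in> X. act g x \<in> X \<inter> ball z \<delta>'}" for g
    by (intro openin_vimage_act) auto
  have "\<exists>T. open T \<and> {x \<in> X. act g x \<in> X \<inter> ball z \<delta>'} = X \<inter> T" for g
    using op[of g] by (simp only: openin_open)
  then obtain T where T: "\<And>g. open (T g)" "\<And>g. {x \<in> X. act g x \<in> X \<inter> ball z \<delta>'} = X \<inter> T g"
    by metis
  have "X \<subseteq> (\<Union>g\<in>UNIV. T g)"
  proof
    fix x assume x: "x \<in> X"
    obtain g where "act g x \<in> ball z \<delta>'"
      using visits_open[OF x, of "ball z \<delta>'"] z \<open>\<delta>' > 0\<close> by (metis IntI centre_in_ball empty_iff open_ball)
    then have "x \<in> X \<inter> T g"
      unfolding T(2)[symmetric] using x act_in by blast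
    then show "x \<in> (\<Union>g\<in>UNIV. T g)" by blast
  qed
  then obtain C where C: "finite C" "X \<subseteq> (\<Union>g\<in>C. T g)"
    using compactE_image[OF compact, of UNIV T] T(1) by metis
  obtain J0 where J0: "set J0 = C"
    using C(1) finite_list by blast
  have *: "\<exists>g\<in>set J0. dist (act g x) z < \<delta>'" if "x \<in> X" for x
  proof -
    obtain g where "g \<in> C" "x \<in> X \<inter> T g"
      using \<open>x \<in> X\<close> C(2) by blast
    then show ?thesis
      unfolding J0 T(2)[symmetric] by (auto simp: dist_commute)
  qed
  show thesis
  proof (rule that)
    show "length J0 > 0"
      using z * by fastforce
    fix y assume y: "y \<in> X"
    obtain t where "act t z \<in> ball y (\<delta> / 2)"
      using visits_open[OF z, of "ball y (\<delta>/2)"] y \<open>\<delta> > 0\<close>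
      by (metis IntI centre_in_ball empty_iff half_gt_zero open_ball)
    then have t: "dist (act t z) y < \<delta> / 2"
      by (simp add: dist_commute)
    have "\<exists>g\<in>set (map (\<lambda>g. t + g) J0). dist (act g x) y < \<delta>" if x: "x \<in> X" for x
    proof -
      obtain g where g: "g \<in> set J0" "dist (act g x) z < \<delta>'"
        using * x by blast
      then have "dist (act t (act g x)) (act t z) < \<delta> / 2"
        using \<delta>'(2) x z act_in by blast
      then have "dist (act t (act g x)) y < \<delta>"
        using t dist_triangle[of "act t (act g x)" y "act t z"] by linarith
      then have "dist (act (t + g) x) y < \<delta>"
        by (simp add: act_add x)
      then show ?thesis
        using g by auto
    qed
    then show "\<exists>J. length J = length J0 \<and> (\<forall>x\<in>X. \<exists>g\<in>set J. dist (act g x) y < \<delta>)"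
      by (intro exI[of _ "map (\<lambda>g. t + g) J0"]) auto
  qed
qed

text \<open>All averages of f share one modulus of continuity. This independence of L matters
  because L is chosen only after \<delta> and the number of translates that \<delta>
  requires.\<close>

lemma uniform_equicontinuity_list_avg:
  assumes "continuous_on X f" "e > 0"
  obtains \<delta> where "\<delta> > 0" "\<And>L x y. L \<noteq> [] \<Longrightarrow> x \<in> X \<Longrightarrow> y \<in> X \<Longrightarrow> dist x y < \<delta> \<Longrightarrow>
     list_avg act L f y \<ge> list_avg act L f x - e"
proof -
  obtain \<eta> where \<eta>: "\<eta> > 0" "\<And>x y. x \<in> X \<Longrightarrow> y \<in> X \<Longrightarrow> dist x y < \<eta> \<Longrightarrow> dist (f x) (f y) < e"
    using compact_uniformly_continuous[OF assms(1) compact] assms(2)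
    unfolding uniformly_continuous_on_def by metis
  obtain \<delta> where \<delta>: "\<delta> > 0"
    "\<And>g x y. x \<in> X \<Longrightarrow> y \<in> X \<Longrightarrow> dist x y < \<delta> \<Longrightarrow> dist (act g x) (act g y) < \<eta>"
    using equicontinuous[OF \<open>\<eta> > 0\<close>] by auto
  show thesis
  proof (rule that[OF \<open>\<delta> > 0\<close>])
    fix L :: "'g list" and x y assume L: "L \<noteq> []" and xy: "x \<in> X" "y \<in> X" "dist x y < \<delta>"
    have "f (act g x) - f (act g y) \<le> e" for g
      using \<eta>(2)[of "act g x" "act g y"] \<delta>(2)[of x y g] xy act_in by (auto simp: dist_real_def)
    then have "(\<Sum>g\<leftarrow>L. f (act g y) - f (act g x)) \<ge> length L * (- e)"
      by (intro sum_list_ge_const) (auto simp: algebra_simps)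
    then have "(\<Sum>g\<leftarrow>L. f (act g x)) \<le> (\<Sum>g\<leftarrow>L. f (act g y)) + e * length L"
      by (simp add: sum_list_subtractf algebra_simps)
    then have "(\<Sum>g\<leftarrow>L. f (act g x)) / length L \<le> ((\<Sum>g\<leftarrow>L. f (act g y)) + e * length L) / length L"
      by (rule divide_right_mono) simp
    then show "list_avg act L f y \<ge> list_avg act L f x - e"
      using L by (simp add: list_avg_def add_divide_distrib)
  qed
qed

text \<open>Among all averages of f, let a be the largest uniform lower bound. If a were smaller
  than the integral of f, a further averaging would raise the infimum of a nearly optimal average
  above a.\<close>

lemma exists_list_avg_ge_integral:
  assumes f: "continuous_on X f" and "e > 0"
  obtains L where "L \<noteq> []" "\<And>x. x \<in> X \<Longrightarrow> list_avg act L f x \<ge> (\<integral>x. f x \<partial>\<nu>) - e"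
proof -
  define I where "I = (\<integral>x. f x \<partial>\<nu>)"
  define C where "C = {c. \<exists>L. L \<noteq> [] \<and> (\<forall>x\<in>X. list_avg act L f x \<ge> c)}"
  define a where "a = Sup C"
  obtain z where z: "z \<in> X"
    using nonempty by blast
  have bdd: "bounded (f ` X)"
    using f compact compact_continuous_image compact_imp_bounded by blast
  then obtain B where B: "\<And>x. x \<in> X \<Longrightarrow> \<bar>f x\<bar> \<le> B"
    by (auto simp: bounded_iff)
  have "list_avg act [0] f x \<ge> - B" if "x \<in> X" for x
    using B[OF act_in[OF that, of 0]] by (intro list_avg_ge) (auto simp: abs_le_iff)
  then have "- B \<in> C"
    unfolding C_def by blast
  then have C_ne: "C \<noteq> {}"
    by auto
  have "c \<le> B" if c: "c \<in> C" for c
  proof -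
    obtain L where L: "L \<noteq> []" "\<forall>x\<in>X. list_avg act L f x \<ge> c"
      using c unfolding C_def by blast
    then have "list_avg act L f z \<ge> c"
      using z by blast
    moreover have "list_avg act L f z \<le> B"
      by (rule list_avg_le[OF L(1)]) (use B[OF act_in[OF z]] in \<open>simp add: abs_le_iff\<close>)
    ultimately show ?thesis
      by linarith
  qed
  then have C_bdd: "bdd_above C"
    by (auto simp: bdd_above_def)
  have "a \<ge> I"
  proof (rule ccontr)
    assume "\<not> a \<ge> I"
    define d where "d = I - a"
    have "d > 0"
      using \<open>\<not> a \<ge> I\<close> by (simp add: d_def)
    obtain \<delta> where \<delta>: "\<delta> > 0" "\<And>L x y. L \<noteq> [] \<Longrightarrow> x \<in> X \<Longrightarrow> y \<in> X \<Longrightarrow> dist x y < \<delta> \<Longrightarrow>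
        list_avg act L f y \<ge> list_avg act L f x - d / 4"
      using uniform_equicontinuity_list_avg[OF f, of "d / 4"] \<open>d > 0\<close> by auto
    obtain k where k: "k > 0"
      "\<And>y. y \<in> X \<Longrightarrow> \<exists>J. length J = k \<and> (\<forall>x\<in>X. \<exists>g\<in>set J. dist (act g x) y < \<delta>)"
      using uniform_return[OF \<open>\<delta> > 0\<close>] by blast
    \<comment> \<open>The good translate will have value at least I - d/2 = a + 2k\<eta>, while all
      others are at least a - \<eta>. The gap (2k + 1)\<eta>, shared among k translates, exceeds the
      loss of \<eta>.\<close>
    define \<eta> where "\<eta> = d / (4 * k)"
    have "\<eta> > 0"
      using \<open>d > 0\<close> k(1) by (simp add: \<eta>_def)
    then obtain c where "c \<in> C" "c > a - \<eta>"
      unfolding a_def using less_cSup_iff[OF C_ne C_bdd, of "Sup C - \<eta>"] by auto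
    then obtain L where L': "L \<noteq> []" "\<And>x. x \<in> X \<Longrightarrow> list_avg act L f x \<ge> c"
      unfolding C_def by blast
    have L: "L \<noteq> []" "\<And>x. x \<in> X \<Longrightarrow> list_avg act L f x \<ge> a - \<eta>"
      using L' \<open>c > a - \<eta>\<close> by force+
    obtain y where y: "y \<in> X" "list_avg act L f y \<ge> I - d / 4"
    proof (rule ccontr)
      assume "\<not> thesis"
      then have "\<forall>y\<in>X. list_avg act L f y \<le> I - d / 4"
        using that by force
      then have "(\<integral>x. list_avg act L f x \<partial>\<nu>) \<le> (\<integral>x. I - d / 4 \<partial>\<nu>)"
        by (intro integral_mono integrable_continuous continuous_on_list_avg f)
          (auto simp: space_\<nu>)
      then show False
        using integral_list_avg[OF f L(1)] \<open>d > 0\<close> by (simp add: prob_space I_def)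
    qed
    obtain J where J: "length J = k" "\<forall>x\<in>X. \<exists>g\<in>set J. dist (act g x) y < \<delta>"
      using k(2)[OF y(1)] by blast
    have "J \<noteq> []"
      using J(1) k(1) by auto
    have "list_avg act J (list_avg act L f) x \<ge> (a - \<eta>) + ((I - d / 2) - (a - \<eta>)) / k"
      if x: "x \<in> X" for x
    proof -
      obtain g where g: "g \<in> set J" "dist (act g x) y < \<delta>"
        using J(2) x by blast
      then have "list_avg act L f (act g x) \<ge> list_avg act L f y - d / 4"
        by (intro \<delta>(2)) (auto simp: L(1) y(1) x act_in dist_commute)
      then have "list_avg act L f (act g x) \<ge> I - d / 2"
        using y(2) by linarith
      with g show ?thesis
        by (intro list_avg_ge_one_good[OF J(1) \<open>J \<noteq> []\<close>]) (auto intro!: L(2) act_in x)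
    qed
    moreover have "(a - \<eta>) + ((I - d / 2) - (a - \<eta>)) / k \<ge> a + \<eta> / k"
    proof -
      have "I - d / 2 = a + 2 * k * \<eta>"
        using k(1) by (simp add: \<eta>_def d_def field_simps)
      then have "(a - \<eta>) + ((I - d / 2) - (a - \<eta>)) / k = a + \<eta> + \<eta> / k"
        using k(1) by (simp add: field_simps)
      then show ?thesis
        using \<open>\<eta> > 0\<close> by simp
    qed
    ultimately have "list_avg act J (list_avg act L f) x \<ge> a + \<eta> / k" if "x \<in> X" for x
      using that by (meson order.trans)
    then have "\<forall>x\<in>X. list_avg act (concat (map (\<lambda>g. map (\<lambda>h. h + g) L) J)) f x \<ge> a + \<eta> / k"
      by (simp add: list_avg_list_avg)
    moreover have "concat (map (\<lambda>g. map (\<lambda>h. h + g) L) J) \<noteq> []"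
      using L(1) \<open>J \<noteq> []\<close> by (auto simp: neq_Nil_conv)
    ultimately have "a + \<eta> / k \<in> C"
      unfolding C_def by blast
    then have "a + \<eta> / k \<le> a"
      unfolding a_def by (rule cSup_upper) (rule C_bdd)
    then show False
      using \<open>\<eta> > 0\<close> k(1) by (simp add: divide_le_0_iff)
  qed
  then obtain c where "c \<in> C" "c > I - e"
    using less_cSup_iff[OF C_ne C_bdd, of "I - e"] \<open>e > 0\<close> unfolding a_def by fastforce
  then obtain L where L: "L \<noteq> []" "\<And>x. x \<in> X \<Longrightarrow> list_avg act L f x \<ge> c"
    unfolding C_def by blast
  show thesis
    by (rule that[OF L(1)]) (use L(2) \<open>c > I - e\<close> I_def in fastforce)
qed

text \<open>Functions are added one at a time. Bounds already obtained hold at every point of X, so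
  they survive the averaging by M; for the new f, the preliminary averaging by L does not change the
  integral.\<close>

lemma exists_common_list_avg:
  assumes "\<And>f. f \<in> set fs \<Longrightarrow> continuous_on X f" and "e > 0"
  shows "\<exists>L. L \<noteq> [] \<and> (\<forall>f\<in>set fs. \<forall>x\<in>X. list_avg act L f x \<ge> (\<integral>x. f x \<partial>\<nu>) - e)"
  using assms(1)
proof (induction fs)
  case Nil
  then show ?case by auto
next
  case (Cons f fs)
  then obtain L where L: "L \<noteq> []"
    "\<And>f x. f \<in> set fs \<Longrightarrow> x \<in> X \<Longrightarrow> list_avg act L f x \<ge> (\<integral>x. f x \<partial>\<nu>) - e"
    by auto
  have f: "continuous_on X f"
    using Cons.prems by auto
  obtain M where M: "M \<noteq> []"
    "\<And>x. x \<in> X \<Longrightarrow> list_avg act M (list_avg act L f) x \<ge> (\<integral>x. list_avg act L f x \<partial>\<nu>) - e"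
    using exists_list_avg_ge_integral[OF continuous_on_list_avg[OF f] \<open>e > 0\<close>] by blast
  let ?N = "concat (map (\<lambda>g. map (\<lambda>h. h + g) L) M)"
  have "?N \<noteq> []"
    using L(1) M(1) by (auto simp: neq_Nil_conv)
  moreover have "list_avg act ?N f x \<ge> (\<integral>x. f x \<partial>\<nu>) - e" if "x \<in> X" for x
    using M(2)[OF that] integral_list_avg[OF f L(1)] by (simp add: list_avg_list_avg that)
  moreover have "list_avg act ?N f' x \<ge> (\<integral>x. f' x \<partial>\<nu>) - e" if "x \<in> X" "f' \<in> set fs" for f' x
  proof -
    have "list_avg act M (list_avg act L f') x \<ge> (\<integral>x. f' x \<partial>\<nu>) - e"
      by (intro list_avg_ge M(1) L(2)) (use that act_in in auto)
    then show ?thesis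
      by (simp add: list_avg_list_avg that)
  qed
  ultimately show ?case
    by (intro exI[of _ ?N]) auto
qed

text \<open>The points p may differ, yet orbit means do not depend on the starting point. A common
  list brings all averages close to the integrals, and some g in that list does at least as well as
  the average of the sums.\<close>

lemma exists_translate_ge_integral:
  fixes cs :: "(('x \<Rightarrow> real) \<times> 'x) list"
  assumes cs: "\<And>f p. (f, p) \<in> set cs \<Longrightarrow> continuous_on X f \<and> p \<in> X"
    and less: "(\<Sum>(f, p)\<leftarrow>cs. \<integral>x. f x \<partial>\<nu>) > c"
  obtains g where "(\<Sum>(f, p)\<leftarrow>cs. f (act g p)) > c"
proof (rule ccontr)
  assume "\<not> thesis"
  then have le: "(\<Sum>(f, p)\<leftarrow>cs. f (act g p)) \<le> c" for g
    using that[of g] not_le by blast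
  define I where "I = (\<Sum>(f, p)\<leftarrow>cs. \<integral>x. f x \<partial>\<nu>)"
  \<comment> \<open>The summand 1 keeps the total error \<open>length cs * e\<close> strictly below
    I - c and covers the empty list.\<close>
  define e where "e = (I - c) / (length cs + 1)"
  have "e > 0"
    using less by (simp add: e_def I_def)
  obtain L where L: "L \<noteq> []"
    "\<And>f x. f \<in> set (map fst cs) \<Longrightarrow> x \<in> X \<Longrightarrow> list_avg act L f x \<ge> (\<integral>x. f x \<partial>\<nu>) - e"
    using exists_common_list_avg[of "map fst cs" e] cs \<open>e > 0\<close> by fastforce
  have "(\<Sum>(f, p)\<leftarrow>cs. list_avg act L f p - (\<integral>x. f x \<partial>\<nu>)) \<ge> length cs * (- e)"
    by (rule sum_list_ge_const) (use L cs in force)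
  moreover have "(\<Sum>(f, p)\<leftarrow>cs. list_avg act L f p - (\<integral>x. f x \<partial>\<nu>)) = (\<Sum>(f, p)\<leftarrow>cs. list_avg act L f p) - I"
    unfolding I_def by (simp add: sum_list_subtractf split_def)
  moreover have "(\<Sum>(f, p)\<leftarrow>cs. list_avg act L f p) = (\<Sum>g\<leftarrow>L. (\<Sum>(f, p)\<leftarrow>cs. f (act g p))) / length L"
    unfolding list_avg_def
    by (induction cs) (auto simp: sum_list_addf add_divide_distrib)
  moreover have "(\<Sum>g\<leftarrow>L. (\<Sum>(f, p)\<leftarrow>cs. f (act g p))) \<le> length L * c"
    by (rule sum_list_le_const) (rule le)
  then have "(\<Sum>g\<leftarrow>L. (\<Sum>(f, p)\<leftarrow>cs. f (act g p))) / length L \<le> c"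
    using L(1) by (simp add: field_simps)
  ultimately have "I - c \<le> length cs * e"
    by simp
  also have "\<dots> < I - c"
    using \<open>e > 0\<close> by (simp add: e_def I_def[symmetric] field_simps)
  finally show False by simp
qed

end

section \<open>Independent sequences in equicontinuous systems\<close>

context equicontinuous_G_system
begin

section \<open>Tent functions approximating a closed set from above\<close>

definition bump :: "'x set \<Rightarrow> real \<Rightarrow> 'x \<Rightarrow> real" where
  "bump B e x = max 0 (1 - infdist x B / e)"

lemma continuous_bump: "continuous_on S (bump B e)"
  unfolding bump_def divide_inverse by (intro continuous_intros)

lemma bump_bounds: "e > 0 \<Longrightarrow> bump B e x \<ge> 0 \<and> bump B e x \<le> 1"
  by (simp add: bump_def infdist_nonneg)

lemma bump_pos_imp: "e > 0 \<Longrightarrow> bump B e x > 0 \<Longrightarrow> infdist x B < e"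
  by (simp add: bump_def max_def field_simps split: if_splits)

lemma bump_mono: "0 < e \<Longrightarrow> e \<le> e' \<Longrightarrow> bump B e x \<le> bump B e' x"
  unfolding bump_def by (intro max.mono diff_left_mono divide_left_mono) (auto simp: infdist_nonneg)

lemma bump_ge_half: "e > 0 \<Longrightarrow> infdist x B \<le> e / 2 \<Longrightarrow> bump B e x \<ge> 1 / 2"
  by (simp add: bump_def max_def field_simps)

lemma integral_bump_ge:
  assumes B: "closedin (top_of_set X) B" and "e > 0"
  shows "(\<integral>x. bump B e x \<partial>\<nu>) \<ge> prob B"
proof -
  have "(\<integral>x. indicat_real B x \<partial>\<nu>) \<le> (\<integral>x. bump B e x \<partial>\<nu>)"
  proof (rule integral_mono)
    show "integrable \<nu> (indicat_real B)"
      using sets_closedin[OF B] by (simp add: emeasure_eq_measure)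
    show "integrable \<nu> (bump B e)"
      by (intro integrable_continuous continuous_bump)
  qed (use \<open>e > 0\<close> in \<open>auto simp: indicator_def bump_bounds bump_def\<close>)
  moreover have "B \<subseteq> space \<nu>"
    using sets_closedin[OF B] sets.sets_into_space by blast
  ultimately show ?thesis
    by (simp add: Int_absorb2)
qed

text \<open>Off the closed set B the shrinking tents vanish eventually, so dominated convergence
  applies. B must be nonempty because \<open>infdist x {}\<close> is 0, which would make the tent
  constantly 1.\<close>

lemma integral_bump_tendsto:
  assumes B: "closedin (top_of_set X) B" and ne: "B \<noteq> {}" and "\<eta> > 0"
  obtains e where "e > 0" "(\<integral>x. bump B e x \<partial>\<nu>) < prob B + \<eta>"
proof -
  have "(\<lambda>n. \<integral>x. bump B (inverse (Suc n)) x \<partial>\<nu>) \<longlonglongrightarrow> (\<integral>x. indicat_real B x \<partial>\<nu>)"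
  proof (rule integral_dominated_convergence[where w = "\<lambda>_. 1"])
    show "AE x in \<nu>. (\<lambda>n. bump B (inverse (Suc n)) x) \<longlonglongrightarrow> indicat_real B x"
    proof (rule AE_I2)
      fix x assume "x \<in> space \<nu>"
      then have x: "x \<in> X" by (simp add: space_\<nu>)
      show "(\<lambda>n. bump B (inverse (Suc n)) x) \<longlonglongrightarrow> indicat_real B x"
      proof (cases "x \<in> B")
        case True
        then show ?thesis by (simp add: bump_def)
      next
        case False
        have "closed B"
          using B compact closedin_compact compact_imp_closed by blast
        then have pos: "infdist x B > 0"
          using False ne by (simp add: infdist_pos_not_in_closed)
        then obtain n where n: "inverse (Suc n) < infdist x B"
          using reals_Archimedean by blast
        have "bump B (inverse (Suc m)) x = 0" if "m \<ge> n" for m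
        proof -
          have "inverse (Suc m) \<le> inverse (real (Suc n))"
            using that by (intro le_imp_inverse_le) auto
          then have "inverse (Suc m) < infdist x B"
            using n by linarith
          then show ?thesis
            using bump_pos_imp[of "inverse (Suc m)" B x] bump_bounds[of "inverse (Suc m)" B x]
            by force
        qed
        then have "\<forall>\<^sub>F m in sequentially. bump B (inverse (Suc m)) x = indicat_real B x"
          using False by (auto simp: eventually_sequentially)
        then show ?thesis
          by (rule tendsto_eventually)
      qed
    qed
  qed (use bump_bounds sets_closedin[OF B] in
      \<open>auto intro!: borel_measurable_continuous continuous_bump\<close>)
  moreover have "B \<subseteq> space \<nu>"
    using sets_closedin[OF B] sets.sets_into_space by blast
  ultimately have "(\<lambda>n. \<integral>x. bump B (inverse (Suc n)) x \<partial>\<nu>) \<longlonglongrightarrow> prob B"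
    by (simp add: Int_absorb2)
  then have "\<forall>\<^sub>F n in sequentially. (\<integral>x. bump B (inverse (Suc n)) x \<partial>\<nu>) < prob B + \<eta>"
    by (rule order_tendstoD(2)) (use \<open>\<eta> > 0\<close> in simp)
  then obtain n where "(\<integral>x. bump B (inverse (Suc n)) x \<partial>\<nu>) < prob B + \<eta>"
    by (auto simp: eventually_sequentially)
  then show thesis
    by (intro that[of "inverse (Suc n)"]) auto
qed

text \<open>Think of a list of pairs (f, p) as the function \<open>\<xi> \<mapsto> \<Sum> f (\<xi> p)\<close> on the compact
  group closure of G, whose Haar integral is the sum of the integrals of f. Then the predicate
  says that the set of \<open>\<xi>\<close> which map P into B has Haar measure at least c.\<close>

definition mean_certificate ::
  "'x set \<Rightarrow> 'x set \<Rightarrow> real \<Rightarrow> real \<Rightarrow> (('x \<Rightarrow> real) \<times> 'x) list \<Rightarrow> bool" where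
  "mean_certificate B P e c cs \<longleftrightarrow>
     (\<forall>(f, p)\<in>set cs. continuous_on X f \<and> p \<in> X) \<and>
     (\<Sum>(f, p)\<leftarrow>cs. \<integral>x. f x \<partial>\<nu>) \<ge> c \<and>
     (\<forall>g. (\<Sum>(f, p)\<leftarrow>cs. f (act g p)) \<le> 1) \<and>
     (\<forall>g. (\<Sum>(f, p)\<leftarrow>cs. f (act g p)) > 0 \<longrightarrow> (\<forall>q\<in>P. infdist (act g q) B < e))"

text \<open>The bound c comes before e: one positive bound for all precisions expresses that, for
  closed B, the elements \<xi> mapping P into B itself have positive Haar measure.\<close>

definition jointly_recurrent :: "'x set \<Rightarrow> 'x set \<Rightarrow> bool" where
  "jointly_recurrent B P \<longleftrightarrow> (\<exists>c>0. \<forall>e>0. \<exists>cs. mean_certificate B P e c cs)"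

text \<open>One pair is enough as a certificate, since the integral of a tent around B is at least
  \<open>prob B\<close> at every scale.\<close>

lemma jointly_recurrent_singleton:
  assumes B: "closedin (top_of_set X) B" and "prob B > 0" and "p \<in> X"
  shows "jointly_recurrent B {p}"
  unfolding jointly_recurrent_def
proof (intro exI[of _ "prob B"] conjI allI impI)
  fix e :: real assume "e > 0"
  then have "mean_certificate B {p} e (prob B) [(bump B e, p)]"
    using integral_bump_ge[OF B] bump_bounds[of e] bump_pos_imp[of e] \<open>p \<in> X\<close>
    by (simp add: mean_certificate_def continuous_bump)
  then show "\<exists>cs. mean_certificate B {p} e (prob B) cs"
    by blast
qed fact

lemma jointly_recurrentD:
  assumes "jointly_recurrent B P" "e > 0"
  obtains g where "\<And>q. q \<in> P \<Longrightarrow> infdist (act g q) B < e"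
proof -
  obtain c cs where c: "c > 0" and cs: "mean_certificate B P e c cs"
    using assms unfolding jointly_recurrent_def by blast
  then have "0 < (\<Sum>(f, p)\<leftarrow>cs. \<integral>x. f x \<partial>\<nu>)"
    by (simp add: mean_certificate_def)
  then obtain g where "0 < (\<Sum>(f, p)\<leftarrow>cs. f (act g p))"
    by (rule exists_translate_ge_integral[rotated]) (use cs in \<open>auto simp: mean_certificate_def\<close>)
  then show thesis
    using that cs unfolding mean_certificate_def by blast
qed

text \<open>A group element moving a point of P near B can fail to move a nearby point q equally near
  to B only if it moves q into a thin shell around B, whose measure is small.\<close>

lemma jointly_recurrent_perturb:
  assumes rec: "jointly_recurrent B P" and B: "closedin (top_of_set X) B" and ne: "B \<noteq> {}"
    and P: "P \<subseteq> X"
  obtains \<delta> where "\<delta> > 0"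
    "\<And>Q. \<lbrakk>finite Q; card Q \<le> N; Q \<subseteq> X; \<And>q. q \<in> Q \<Longrightarrow> \<exists>p\<in>P. dist p q < \<delta>\<rbrakk> \<Longrightarrow> jointly_recurrent B Q"
proof -
  obtain c where c: "c > 0" "\<And>e. e > 0 \<Longrightarrow> \<exists>cs. mean_certificate B P e c cs"
    using rec unfolding jointly_recurrent_def by blast
  \<comment> \<open>Each of at most N points will cost at most 2\<eta> in the mean, so c/2 of the
    bound c remains. The summand 1 avoids division by zero.\<close>
  define \<eta> where "\<eta> = c / (4 * (N + 1))"
  have "\<eta> > 0"
    using c(1) by (simp add: \<eta>_def)
  obtain e0 where e0: "e0 > 0" "(\<integral>x. bump B e0 x \<partial>\<nu>) < prob B + \<eta>"
    using integral_bump_tendsto[OF B ne \<open>\<eta> > 0\<close>] by blast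
  obtain \<delta> where \<delta>: "\<delta> > 0"
    "\<And>g x y. x \<in> X \<Longrightarrow> y \<in> X \<Longrightarrow> dist x y < \<delta> \<Longrightarrow> dist (act g x) (act g y) < e0 / 4"
    using equicontinuous[of "e0 / 4"] e0(1) by auto
  \<comment> \<open>The certificate for P is taken once, at scale e0/4, before Q and the precision
    for Q are known; only the penalty added to it depends on that precision. A point q close to P is
    then moved within e0/4 + e0/4 of B.\<close>
  obtain cs where cs: "mean_certificate B P (e0 / 4) c cs"
    using c(2)[of "e0 / 4"] e0(1) by auto
  show thesis
  proof (rule that[OF \<open>\<delta> > 0\<close>])
    fix Q assume Q: "finite Q" "card Q \<le> N" "Q \<subseteq> X" "\<And>q. q \<in> Q \<Longrightarrow> \<exists>p\<in>P. dist p q < \<delta>"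
    obtain qs where qs: "set qs = Q" "distinct qs"
      using finite_distinct_list[OF Q(1)] by blast
    have len: "length qs \<le> N"
      using Q(2) qs distinct_card by fastforce
    show "jointly_recurrent B Q"
      unfolding jointly_recurrent_def
    proof (intro exI[of _ "c / 2"] conjI allI impI)
      fix e :: real assume "e > 0"
      define e' where "e' = min e e0"
      have e': "e' > 0" "e' \<le> e0" "e' \<le> e"
        using \<open>e > 0\<close> e0(1) by (auto simp: e'_def)
      \<comment> \<open>A penalty concentrated on the shell around B. At distance between e' and
        e0/2 the narrow tent vanishes and the wide one is at least 1/2, so the factor 2 gives a
        value of at most -1, which cancels a certificate sum of at most 1.\<close>
      define s where "s x = 2 * (bump B e' x - bump B e0 x)" for x
      have s_le: "s x \<le> 0" for x
        using bump_mono[OF e'(1,2)] by (simp add: s_def)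
      have cont_s: "continuous_on X s"
        unfolding s_def by (intro continuous_intros continuous_bump)
      have int_s: "(\<integral>x. s x \<partial>\<nu>) \<ge> - 2 * \<eta>"
      proof -
        have "(\<integral>x. s x \<partial>\<nu>) = 2 * ((\<integral>x. bump B e' x \<partial>\<nu>) - (\<integral>x. bump B e0 x \<partial>\<nu>))"
          unfolding s_def by (simp add: integrable_continuous continuous_bump)
        then show ?thesis
          using integral_bump_ge[OF B e'(1)] e0(2) by simp
      qed
      let ?cs = "cs @ map (\<lambda>q. (s, q)) qs"
      have val: "(\<Sum>(f, p)\<leftarrow>?cs. f (act g p)) = (\<Sum>(f, p)\<leftarrow>cs. f (act g p)) + (\<Sum>q\<leftarrow>qs. s (act g q))" for g
        by (simp add: o_def)
      have nonpos: "(\<Sum>q\<leftarrow>qs. s (act g q)) \<le> 0" for g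
        using sum_list_le_const[of qs "\<lambda>q. s (act g q)" 0] s_le by simp
      have "mean_certificate B Q e (c / 2) ?cs"
        unfolding mean_certificate_def
      proof (intro conjI allI impI ballI)
        show "\<And>x. x \<in> set ?cs \<Longrightarrow> case x of (f, p) \<Rightarrow> continuous_on X f \<and> p \<in> X"
          using cs cont_s qs Q(3) by (auto simp: mean_certificate_def)
        have "(\<Sum>(f, p)\<leftarrow>map (\<lambda>q. (s, q)) qs. \<integral>x. f x \<partial>\<nu>) \<ge> length qs * (- 2 * \<eta>)"
          using sum_list_ge_const[of "map (\<lambda>q. (s, q)) qs" "- 2 * \<eta>" "\<lambda>(f, p). \<integral>x. f x \<partial>\<nu>"] int_s by force
        moreover have "length qs * (2 * \<eta>) \<le> N * (2 * \<eta>)"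
          using len \<open>\<eta> > 0\<close> by (intro mult_right_mono) auto
        moreover have "N * (2 * \<eta>) \<le> c / 2"
          using c(1) by (simp add: \<eta>_def field_simps)
        ultimately have "(\<Sum>(f, p)\<leftarrow>map (\<lambda>q. (s, q)) qs. \<integral>x. f x \<partial>\<nu>) \<ge> - (c / 2)"
          by simp
        then show "(\<Sum>(f, p)\<leftarrow>?cs. \<integral>x. f x \<partial>\<nu>) \<ge> c / 2"
          using cs by (simp add: mean_certificate_def)
        show "(\<Sum>(f, p)\<leftarrow>?cs. f (act g p)) \<le> 1" for g
          using cs nonpos[of g] unfolding val mean_certificate_def by (metis add.commute add_mono add_0)
        fix g q assume pos: "(\<Sum>(f, p)\<leftarrow>?cs. f (act g p)) > 0" and q: "q \<in> Q"
        have "(\<Sum>(f, p)\<leftarrow>cs. f (act g p)) > 0"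
          using pos nonpos[of g] unfolding val by linarith
        then have near: "\<forall>p\<in>P. infdist (act g p) B < e0 / 4"
          using cs by (simp add: mean_certificate_def)
        obtain p where p: "p \<in> P" "dist p q < \<delta>"
          using Q(4)[OF q] by blast
        have "infdist (act g q) B \<le> infdist (act g p) B + dist (act g q) (act g p)"
          by (rule infdist_triangle)
        moreover have "dist (act g p) (act g q) < e0 / 4"
          using \<delta>(2) p q P Q(3) by blast
        ultimately have half: "infdist (act g q) B \<le> e0 / 2"
          using near p(1) by (force simp: dist_commute)
        show "infdist (act g q) B < e"
        proof (rule ccontr)
          assume "\<not> infdist (act g q) B < e"
          then have "bump B e' (act g q) \<le> 0"
            using bump_pos_imp[OF e'(1), of B "act g q"] e'(3) by force
          then have "s (act g q) \<le> - 1"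
            using bump_ge_half[OF e0(1) half] by (simp add: s_def)
          moreover obtain q1 q2 where split: "qs = q1 @ q # q2"
            using q qs(1) by (meson split_list)
          moreover have "(\<Sum>q\<leftarrow>q1. s (act g q)) \<le> 0" "(\<Sum>q\<leftarrow>q2. s (act g q)) \<le> 0"
            using sum_list_le_const[of _ "\<lambda>q. s (act g q)" 0] s_le by simp_all
          ultimately have "(\<Sum>q\<leftarrow>qs. s (act g q)) \<le> - 1"
            by simp
          moreover have "(\<Sum>(f, p)\<leftarrow>cs. f (act g p)) \<le> 1"
            using cs by (simp add: mean_certificate_def)
          ultimately show False
            using pos unfolding val by linarith
        qed
      qed
      then show "\<exists>cs. mean_certificate B Q e (c / 2) cs"
        by blast
    qed (use c(1) in simp)
  qed
qed

lemma nearby_points_same_pattern: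
  fixes O' :: "bool \<Rightarrow> 'x set" and g :: "nat \<Rightarrow> 'g"
  assumes "finite P" "P \<subseteq> X" "\<And>b. openin (top_of_set X) (O' b)"
  obtains \<delta> where "\<delta> > 0" "\<And>p q i b. p \<in> P \<Longrightarrow> q \<in> X \<Longrightarrow> dist p q < \<delta> \<Longrightarrow> i < n \<Longrightarrow>
     act (g i) p \<in> O' b \<Longrightarrow> act (g i) q \<in> O' b"
proof -
  have ex: "\<exists>d>0. \<forall>q\<in>X. dist p q < d \<longrightarrow> act (g i) p \<in> O' b \<longrightarrow> act (g i) q \<in> O' b"
    if p: "p \<in> P" for p i b
  proof (cases "act (g i) p \<in> O' b")
    case True
    have "openin (top_of_set X) {x \<in> X. act (g i) x \<in> O' b}"
      by (rule openin_vimage_act) (rule assms)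
    moreover have "p \<in> {x \<in> X. act (g i) x \<in> O' b}"
      using True p assms(2) by blast
    ultimately obtain d where "d > 0" "\<forall>q\<in>X. dist q p < d \<longrightarrow> q \<in> {x \<in> X. act (g i) x \<in> O' b}"
      unfolding openin_euclidean_subtopology_iff by blast
    then show ?thesis
      by (auto simp: dist_commute)
  qed (auto intro: exI[of _ 1])
  define d where "d p i b = (SOME d. d > 0 \<and> (\<forall>q\<in>X. dist p q < d \<longrightarrow> act (g i) p \<in> O' b \<longrightarrow> act (g i) q \<in> O' b))"
    for p i b
  have d: "d p i b > 0 \<and> (\<forall>q\<in>X. dist p q < d p i b \<longrightarrow> act (g i) p \<in> O' b \<longrightarrow> act (g i) q \<in> O' b)"
    if "p \<in> P" for p i b
    unfolding d_def by (rule someI_ex) (use ex[OF that, of i b] in blast)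
  define D where "D = insert 1 ((\<lambda>(p, i, b). d p i b) ` (P \<times> {..<n} \<times> (UNIV :: bool set)))"
  have "finite D"
    using assms(1) by (simp add: D_def)
  show thesis
  proof (rule that[of "Min D"])
    show "Min D > 0"
      using \<open>finite D\<close> d by (subst Min_gr_iff) (auto simp: D_def)
    fix p q i b assume *: "p \<in> P" "q \<in> X" "dist p q < Min D" "i < n" "act (g i) p \<in> O' b"
    have "d p i b \<in> D"
      unfolding D_def using *(1,4) by (intro insertI2 image_eqI[of _ _ "(p, i, b)"]) auto
    then have "Min D \<le> d p i b"
      using \<open>finite D\<close> by simp
    then show "act (g i) q \<in> O' b"
      using d[OF *(1), of i b] *(2,3,5) by (meson order.strict_trans2)
  qed
qed

text \<open>Every p in P is doubled. Once \<open>act t p\<close> is close to B, which lies in both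
  closures, there are points of \<open>O' True\<close> and \<open>O' False\<close> near it, and
  their pull-backs by \<open>- t\<close> replace p. They are so close to p that the old entries of
  the pattern and joint recurrence persist.\<close>

lemma extend_pattern:
  fixes O' :: "bool \<Rightarrow> 'x set" and g :: "nat \<Rightarrow> 'g" and n :: nat
  assumes O: "\<And>b. openin (top_of_set X) (O' b)"
    and B: "closedin (top_of_set X) B" "B \<noteq> {}" "\<And>b. B \<subseteq> closure (O' b)"
    and P: "finite P" "P \<subseteq> X" "jointly_recurrent B P"
    and pat: "\<And>\<sigma>. \<exists>p\<in>P. \<forall>i<n. act (g i) p \<in> O' (\<sigma> i)"
  shows "\<exists>t Q. finite Q \<and> Q \<subseteq> X \<and> jointly_recurrent B Q \<and>
    (\<forall>\<sigma>. \<exists>p\<in>Q. (\<forall>i<n. act (g i) p \<in> O' (\<sigma> i)) \<and> act t p \<in> O' (\<sigma> n))"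
proof -
  obtain \<delta>1 where \<delta>1: "\<delta>1 > 0" "\<And>p q i b. p \<in> P \<Longrightarrow> q \<in> X \<Longrightarrow> dist p q < \<delta>1 \<Longrightarrow> i < n \<Longrightarrow>
     act (g i) p \<in> O' b \<Longrightarrow> act (g i) q \<in> O' b"
    by (rule nearby_points_same_pattern[OF P(1,2) O, of n g]) (rule that)
  obtain \<delta>2 where \<delta>2: "\<delta>2 > 0"
    "\<And>Q. \<lbrakk>finite Q; card Q \<le> 2 * card P; Q \<subseteq> X; \<And>q. q \<in> Q \<Longrightarrow> \<exists>p\<in>P. dist p q < \<delta>2\<rbrakk> \<Longrightarrow> jointly_recurrent B Q"
    by (rule jointly_recurrent_perturb[OF P(3) B(1,2) P(2), of "2 * card P"]) (rule that, assumption, blast)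
  \<comment> \<open>This e works for all group elements, so it controls the pull-back by
    \<open>- t\<close> although t is found only afterwards and depends on e.\<close>
  obtain e where e: "e > 0"
    "\<And>g x y. x \<in> X \<Longrightarrow> y \<in> X \<Longrightarrow> dist x y < e \<Longrightarrow> dist (act g x) (act g y) < min \<delta>1 \<delta>2"
    using equicontinuous[of "min \<delta>1 \<delta>2"] \<delta>1(1) \<delta>2(1) by auto
  obtain t where t: "\<And>q. q \<in> P \<Longrightarrow> infdist (act t q) B < e / 2"
    by (rule jointly_recurrentD[OF P(3), of "e / 2"]) (use e(1) that in auto)
  have BX: "B \<subseteq> X" and OX: "O' b \<subseteq> X" for b
    using closedin_imp_subset[OF B(1)] openin_imp_subset[OF O] by auto
  have "\<exists>y\<in>O' b. dist (act t p) y < e" if p: "p \<in> P" for p b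
  proof -
    have "Inf (dist (act t p) ` B) < e / 2"
      using t[OF p] B(2) by (simp add: infdist_def)
    then obtain z where z: "z \<in> B" "dist (act t p) z < e / 2"
      using cInf_lessD[of "dist (act t p) ` B" "e / 2"] B(2) by blast
    obtain y where y: "y \<in> O' b" "dist y z < e / 2"
      using B(3)[of b] z(1) e(1) by (meson half_gt_zero subsetD closure_approachable)
    have "dist (act t p) y < e"
      using dist_triangle_half_l[OF z(2) y(2)] .
    then show ?thesis
      using y(1) by blast
  qed
  then obtain y where y: "\<And>p b. p \<in> P \<Longrightarrow> y p b \<in> O' b" "\<And>p b. p \<in> P \<Longrightarrow> dist (act t p) (y p b) < e"
    by metis
  define r where "r = (\<lambda>(p, b). act (- t) (y p b))"
  define Q where "Q = r ` (P \<times> UNIV)"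
  have near: "dist p (r (p, b)) < min \<delta>1 \<delta>2" if p: "p \<in> P" for p b
    using e(2)[of "act t p" "y p b" "- t"] y[OF p] OX p P(2) act_in
    by (auto simp: r_def act_uminus_act subset_iff)
  have rX: "r (p, b) \<in> X" if "p \<in> P" for p b
    using act_in[OF subsetD[OF OX y(1)[OF that]]] by (simp add: r_def)
  have "card Q \<le> card (P \<times> (UNIV :: bool set))"
    unfolding Q_def by (rule card_image_le) (use P(1) in simp)
  then have "card Q \<le> 2 * card P"
    by (simp add: card_cartesian_product)
  moreover have "finite Q" "Q \<subseteq> X"
    using P(1) rX by (auto simp: Q_def)
  moreover have "\<exists>p\<in>P. dist p q < \<delta>2" if "q \<in> Q" for q
    using that near by (force simp: Q_def)
  ultimately have "jointly_recurrent B Q"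
    by (intro \<delta>2(2))
  moreover have "\<exists>p\<in>Q. (\<forall>i<n. act (g i) p \<in> O' (\<sigma> i)) \<and> act t p \<in> O' (\<sigma> n)" for \<sigma>
  proof -
    obtain p where p: "p \<in> P" "\<forall>i<n. act (g i) p \<in> O' (\<sigma> i)"
      using pat by blast
    let ?q = "r (p, \<sigma> n)"
    have "?q \<in> Q"
      using p(1) by (simp add: Q_def)
    moreover have "act (g i) ?q \<in> O' (\<sigma> i)" if "i < n" for i
      using \<delta>1(2)[OF p(1) rX[OF p(1)] _ that] near[OF p(1), of "\<sigma> n"] p(2) that by simp
    moreover have "act t ?q \<in> O' (\<sigma> n)"
      using y(1)[OF p(1), of "\<sigma> n"] OX by (simp add: r_def act_act_uminus subset_iff)
    ultimately show ?thesis
      by blast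
  qed
  ultimately show ?thesis
    using \<open>finite Q\<close> \<open>Q \<subseteq> X\<close> by blast
qed

text \<open>The recursion chooses entire functions \<open>G n\<close>, of which only the first n
  values are constrained and kept at the next stage. The sequence sought is their diagonal.\<close>

theorem independent_sequence:
  fixes O' :: "bool \<Rightarrow> 'x set"
  assumes O: "\<And>b. openin (top_of_set X) (O' b)"
    and B: "closedin (top_of_set X) B" "\<And>b. B \<subseteq> closure (O' b)" and pos: "prob B > 0"
  obtains g :: "nat \<Rightarrow> 'g" where "\<And>n \<sigma>. \<exists>x\<in>X. \<forall>i<n. act (g i) x \<in> O' (\<sigma> i)"
proof -
  have ne: "B \<noteq> {}"
    using pos by auto
  define good where "good n g \<longleftrightarrow> (\<exists>P. finite P \<and> P \<subseteq> X \<and> jointly_recurrent B P \<and>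
      (\<forall>\<sigma>. \<exists>p\<in>P. \<forall>i<n. act (g i) p \<in> O' (\<sigma> i)))" for n and g :: "nat \<Rightarrow> 'g"
  have "\<exists>G. \<forall>n. good n (G n) \<and> (\<forall>i<n. G (Suc n) i = G n i)"
  proof (rule dependent_nat_choice)
    obtain p where "p \<in> X"
      using nonempty by blast
    then have "good 0 g" for g
      unfolding good_def using jointly_recurrent_singleton[OF B(1) pos] by (intro exI[of _ "{p}"]) auto
    then show "\<exists>g. good 0 g"
      by blast
  next
    fix g n assume "good n g"
    then obtain P where P: "finite P" "P \<subseteq> X" "jointly_recurrent B P"
      "\<And>\<sigma>. \<exists>p\<in>P. \<forall>i<n. act (g i) p \<in> O' (\<sigma> i)"
      unfolding good_def by blast
    obtain t Q where Q: "finite Q" "Q \<subseteq> X" "jointly_recurrent B Q"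
      "\<And>\<sigma>. \<exists>p\<in>Q. (\<forall>i<n. act (g i) p \<in> O' (\<sigma> i)) \<and> act t p \<in> O' (\<sigma> n)"
      using extend_pattern[of O' B P n g, OF O B(1) ne B(2) P] by blast
    have "\<exists>p\<in>Q. \<forall>i<Suc n. act ((g(n := t)) i) p \<in> O' (\<sigma> i)" for \<sigma>
      using Q(4)[of \<sigma>] by (auto simp: less_Suc_eq)
    then have "good (Suc n) (g(n := t))"
      unfolding good_def using Q(1-3) by blast
    then show "\<exists>g'. good (Suc n) g' \<and> (\<forall>i<n. g' i = g i)"
      by (intro exI[of _ "g(n := t)"]) auto
  qed
  then obtain G where G: "\<And>n. good n (G n)" "\<And>n i. i < n \<Longrightarrow> G (Suc n) i = G n i"
    by blast
  \<comment> \<open>Entry i is fixed from stage \<open>Suc i\<close> on, so the diagonal is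
    \<open>G (Suc i) i\<close> and not \<open>G i i\<close>.\<close>
  have stable: "G (i + k + 1) i = G (Suc i) i" for i k
    by (induction k) (auto simp: G(2))
  have "\<exists>x\<in>X. \<forall>i<n. act (G (Suc i) i) x \<in> O' (\<sigma> i)" for n \<sigma>
  proof -
    obtain x where x: "x \<in> X" "\<forall>i<n. act (G n i) x \<in> O' (\<sigma> i)"
      using G(1)[of n] unfolding good_def by blast
    have "G n i = G (Suc i) i" if "i < n" for i
      using stable[of i "n - i - 1"] that by simp
    then show ?thesis
      using x by auto
  qed
  then show thesis
    by (rule that)
qed

end

section \<open>Tameness excludes independence\<close>

lemma closed_frequently_limit:
  assumes "(f \<longlongrightarrow> l) F" "closed C" "\<exists>\<^sub>F x in F. f x \<in> C"
  shows "l \<in> C"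
proof (rule ccontr)
  assume "l \<notin> C"
  then have "\<forall>\<^sub>F x in F. f x \<in> - C"
    using assms(1,2) by (intro topological_tendstoD[of f l]) auto
  with assms(3) show False
    by (simp add: frequently_def)
qed

lemma infinite_nat_splits:
  assumes "infinite (S :: nat set)"
  obtains E where "infinite (S \<inter> E)" "infinite (S - E)"
proof -
  define e where "e = enumerate S"
  have inj: "inj e" and S: "range e \<subseteq> S"
    using assms strict_mono_enumerate strict_mono_imp_inj_on enumerate_in_set by (auto simp: e_def)
  have "infinite (range (\<lambda>n. e (2 * n)))" "infinite (range (\<lambda>n. e (2 * n + 1)))"
    by (intro range_inj_infinite injI, simp add: inj_eq[OF inj])+
  moreover have "range (\<lambda>n. e (2 * n)) \<subseteq> S \<inter> range (\<lambda>n. e (2 * n))"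
    using S by auto
  moreover have "range (\<lambda>n. e (2 * n + 1)) \<subseteq> S - range (\<lambda>n. e (2 * n))"
  proof -
    have "e (2 * n + 1) \<noteq> e (2 * m)" for n m
    proof
      assume "e (2 * n + 1) = e (2 * m)"
      then have "2 * n + 1 = 2 * m"
        using inj by (simp add: inj_eq)
      then show False by presburger
    qed
    then show ?thesis
      using S by auto
  qed
  ultimately show thesis
    using that infinite_super by blast
qed

lemma frequently_sequentially_infinite:
  "infinite {k. P k} \<Longrightarrow> \<exists>\<^sub>F k :: nat in sequentially. P k"
  by (metis INFM_iff_infinite cofinite_eq_sequentially)

text \<open>Independence is required in the weak form that fibres can provide: a finite set F for
  each pattern, with some point of F in A at the true entries and all points of F in B at the false
  ones. A pattern alternating along the indices of a convergent subsequence puts one limit value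
  into both A and B.\<close>

lemma tame_no_independent_sequence:
  fixes act :: "'g::group_add \<Rightarrow> 'x::metric_space \<Rightarrow> 'x" and g :: "nat \<Rightarrow> 'g"
  assumes sys: "G_system act X" and tame: "tame_system act X"
    and closed: "closed A" "closed B" and disj: "A \<inter> B = {}"
    and indep: "\<And>\<sigma> :: nat \<Rightarrow> bool. \<exists>F. finite F \<and> F \<subseteq> X \<and>
      (\<forall>n. (\<sigma> n \<longrightarrow> (\<exists>x\<in>F. act (g n) x \<in> A)) \<and> (\<not> \<sigma> n \<longrightarrow> (\<forall>x\<in>F. act (g n) x \<in> B)))"
  shows False
proof -
  define T where "T = pointwise_top X"
  define E where "E = enveloping_semigroup act X"
  define a where "a n = restrict (act (g n)) X" for n
  have topT: "topspace T = (\<Pi>\<^sub>E x\<in>X. X)"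
    by (simp add: T_def pointwise_top_def)
  have orbit: "{restrict (act h) X | h. True} \<subseteq> topspace T"
    using sys unfolding topT G_system_def by fastforce
  then have orbE: "{restrict (act h) X | h. True} \<subseteq> E"
    unfolding E_def enveloping_semigroup_def T_def by (rule closure_of_subset)
  have aO: "range a \<subseteq> {restrict (act h) X | h. True}"
    by (auto simp: a_def)
  \<comment> \<open>The pattern that is true only at n has a point sent into A by \<open>g n\<close>
    and into B by \<open>g m\<close>.\<close>
  have neq: "a n \<noteq> a m" if "n \<noteq> m" for n m
  proof -
    obtain F where F: "F \<subseteq> X" and "\<forall>k. ((k = n) \<longrightarrow> (\<exists>x\<in>F. act (g k) x \<in> A)) \<and> (k \<noteq> n \<longrightarrow> (\<forall>x\<in>F. act (g k) x \<in> B))"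
      using indep[of "\<lambda>k. k = n"] by blast
    then obtain x where "x \<in> F" "act (g n) x \<in> A" "act (g m) x \<in> B"
      using \<open>n \<noteq> m\<close> by metis
    then have "a n x \<noteq> a m x"
      using F disj by (auto simp: a_def)
    then show ?thesis by auto
  qed
  then have inf: "infinite (range a)"
    by (intro range_inj_infinite injI) blast
  have "compact_space T"
    using sys by (simp add: T_def pointwise_top_def compact_space_product_topology
        compact_space_subtopology compactin_euclidean_iff G_system_def)
  then obtain p where p: "p \<in> T derived_set_of range a"
    using compactin_imp_Bolzano_Weierstrass[of T "topspace T" "range a"] inf aO orbit
    by (auto simp: compact_space_def)
  \<comment> \<open>Removing p from the range prevents the approximating sequence from repeating p,
    so that its indices must take infinitely many values.\<close>
  then have p_cl: "p \<in> T closure_of (range a - {p})"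
    unfolding derived_set_of_def closure_of_def by auto
  have "p \<in> E"
    using p_cl closure_of_mono[of "range a - {p}" "{restrict (act h) X | h. True}" T] aO
    unfolding E_def enveloping_semigroup_def T_def by blast
  have sub: "range a - {p} \<subseteq> E"
    using aO orbE by blast
  have "p \<in> subtopology T E closure_of (range a - {p})"
    using p_cl \<open>p \<in> E\<close> sub by (simp add: closure_of_subtopology Int_absorb1)
  moreover have "range a - {p} \<subseteq> topspace (subtopology T E)"
    using sub aO orbit by auto
  moreover have "frechet_space (subtopology T E)"
    using tame by (simp add: tame_system_def T_def E_def)
  ultimately obtain s :: "nat \<Rightarrow> 'x \<Rightarrow> 'x" where
    s: "range s \<subseteq> range a - {p}" "limitin (subtopology T E) s p sequentially"
    unfolding frechet_space_def by blast
  then have "\<forall>k. \<exists>i. s k = a i"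
    by blast
  then obtain m where m: "\<And>k. s k = a (m k)"
    by metis
  have lim: "limitin T s p sequentially"
    using s(2) by (simp add: limitin_subtopology)
  have p_ext: "p \<in> extensional X"
    using lim by (simp add: T_def pointwise_top_def limitin_componentwise)
  have conv: "(\<lambda>k. act (g (m k)) x) \<longlonglongrightarrow> p x" if "x \<in> X" for x
  proof -
    have "limitin (top_of_set X) (\<lambda>k. s k x) (p x) sequentially"
      using lim that by (simp add: T_def pointwise_top_def limitin_componentwise)
    then show ?thesis
      using that by (simp add: limitin_subtopology m a_def)
  qed
  \<comment> \<open>Otherwise one index recurs infinitely often, and pointwise convergence
    identifies p with the corresponding \<open>a (m j)\<close>, which was removed. Both functions
    are extensional, so agreement on X is equality.\<close>
  have "infinite (range m)"
  proof
    assume "finite (range m)"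
    then obtain j where "infinite {k. m k = m j}"
      using pigeonhole_infinite[of UNIV m] by auto
    then have "\<exists>\<^sub>F k in sequentially. m k = m j"
      by (rule frequently_sequentially_infinite)
    then have "\<exists>\<^sub>F k in sequentially. act (g (m k)) x \<in> {act (g (m j)) x}" for x
      by (rule frequently_elim1) simp
    then have "p x = a (m j) x" if "x \<in> X" for x
      using closed_frequently_limit[OF conv[OF that] closed_singleton] that by (auto simp: a_def)
    then have "p = a (m j)"
      using p_ext by (intro extensionalityI[of p X]) (auto simp: a_def)
    then show False
      using s(1) m[of j] by auto
  qed
  then obtain S where S: "infinite (range m \<inter> S)" "infinite (range m - S)"
    using infinite_nat_splits by blast
  have "range m \<inter> S = m ` {k. m k \<in> S}" "range m - S = m ` {k. m k \<notin> S}"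
    by auto
  then have "infinite {k. m k \<in> S}" "infinite {k. m k \<notin> S}"
    using S finite_imageI by metis+
  then have freq: "\<exists>\<^sub>F k in sequentially. m k \<in> S" "\<exists>\<^sub>F k in sequentially. m k \<notin> S"
    by (simp_all add: frequently_sequentially_infinite)
  obtain F where F: "finite F" "F \<subseteq> X" 
    "\<And>n. n \<in> S \<Longrightarrow> \<exists>x\<in>F. act (g n) x \<in> A" "\<And>n x. n \<notin> S \<Longrightarrow> x \<in> F \<Longrightarrow> act (g n) x \<in> B"
    using indep[of "\<lambda>n. n \<in> S"] by blast
  have "\<exists>\<^sub>F k in sequentially. \<exists>x\<in>F. act (g (m k)) x \<in> A"
    using freq(1) by (rule frequently_elim1) (rule F(3))
  \<comment> \<open>F is finite, so infinitely many visits to A by varying points of F yield one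
    point visiting A infinitely often. The same point is in B whenever \<open>m k\<close> is outside
    S, since that condition concerns all of F.\<close>
  then obtain x where x: "x \<in> F" "\<exists>\<^sub>F k in sequentially. act (g (m k)) x \<in> A"
    using eventually_ball_finite[OF F(1), of "\<lambda>k x. act (g (m k)) x \<notin> A" sequentially]
    unfolding frequently_def by auto
  have "x \<in> X"
    using x(1) F(2) by blast
  have "p x \<in> A"
    by (rule closed_frequently_limit[OF conv[OF \<open>x \<in> X\<close>] closed(1) x(2)])
  moreover have "p x \<in> B"
    by (rule closed_frequently_limit[OF conv[OF \<open>x \<in> X\<close>] closed(2)])
      (rule frequently_elim1[OF freq(2)], rule F(4)[OF _ x(1)])
  ultimately show False
    using disj by blast
qed

section \<open>Compactness in the space of sequences\<close>

lemma compact_sequences: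
  assumes "compact (X :: 'x::metric_space set)"
  shows "compact {x :: nat \<Rightarrow> 'x. \<forall>j. x j \<in> X}"
proof -
  have "compactin (product_topology (\<lambda>_ :: nat. euclidean) UNIV) (PiE UNIV (\<lambda>_. X))"
    using assms by (simp add: compactin_PiE compactin_euclidean_iff)
  then show ?thesis
    by (simp add: euclidean_product_topology compactin_euclidean_iff PiE_UNIV_domain Pi_def)
qed

lemma closed_sequences_component:
  assumes "compact (X :: 'x::metric_space set)" "continuous_on X f" "closed A"
  shows "closed {x :: nat \<Rightarrow> 'x. (\<forall>j. x j \<in> X) \<and> f (x k) \<in> A}"
proof -
  let ?T = "{x :: nat \<Rightarrow> 'x. \<forall>j. x j \<in> X}"
  have "continuous_on ?T (\<lambda>x. f (x k))"
    by (rule continuous_on_compose2[OF assms(2)]) (auto intro: continuous_on_subset[OF continuous_on_product_coordinates])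
  then have "closed (?T \<inter> (\<lambda>x. f (x k)) -` A)"
    by (intro continuous_closed_preimage assms(3) compact_imp_closed compact_sequences assms(1))
  then show ?thesis
    by (simp add: vimage_def Int_def)
qed

text \<open>Tuples are encoded as infinite sequences, of which only the first K entries are
  constrained; Tychonoff then applies. Each entry of the pattern is a closed condition, a finite
  union or an intersection over j < K, and K does not depend on n, so the finite intersection
  property gives the limit.\<close>

lemma finite_patterns_imp_infinite_pattern:
  fixes f :: "nat \<Rightarrow> 'x::metric_space \<Rightarrow> 'y::topological_space"
  assumes X: "compact X" and f: "\<And>i. continuous_on X (f i)" and AB: "closed A" "closed B"
    and fin: "\<And>n. \<exists>x :: nat \<Rightarrow> 'x. (\<forall>j. x j \<in> X) \<and>
      (\<forall>i<n. (\<sigma> i \<longrightarrow> (\<exists>j<K. f i (x j) \<in> A)) \<and> (\<not> \<sigma> i \<longrightarrow> (\<forall>j<K. f i (x j) \<in> B)))"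
  shows "\<exists>x :: nat \<Rightarrow> 'x. (\<forall>j. x j \<in> X) \<and>
      (\<forall>i. (\<sigma> i \<longrightarrow> (\<exists>j<K. f i (x j) \<in> A)) \<and> (\<not> \<sigma> i \<longrightarrow> (\<forall>j<K. f i (x j) \<in> B)))"
proof -
  let ?T = "{x :: nat \<Rightarrow> 'x. \<forall>j. x j \<in> X}"
  define cond where "cond i x \<longleftrightarrow>
    (\<sigma> i \<longrightarrow> (\<exists>j<K. f i (x j) \<in> A)) \<and> (\<not> \<sigma> i \<longrightarrow> (\<forall>j<K. f i (x j) \<in> B))" for i and x :: "nat \<Rightarrow> 'x"
  have fin': "\<exists>x. (\<forall>j. x j \<in> X) \<and> (\<forall>i<n. cond i x)" for n
    using fin unfolding cond_def .
  define Z where "Z i = {x \<in> ?T. cond i x}" for i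
  have closed_Z: "closed (Z i)" for i
  proof (cases "\<sigma> i")
    case True
    have "Z i = (\<Union>j<K. {x. (\<forall>j. x j \<in> X) \<and> f i (x j) \<in> A})"
      using True by (auto simp: Z_def cond_def)
    then show ?thesis
      using closed_sequences_component[OF X f AB(1)] by auto
  next
    case False
    have "Z i = ?T \<inter> (\<Inter>j<K. {x. (\<forall>j. x j \<in> X) \<and> f i (x j) \<in> B})"
      using False by (auto simp: Z_def cond_def)
    moreover have "closed (\<Inter>j<K. {x. (\<forall>j. x j \<in> X) \<and> f i (x j) \<in> B})"
      using closed_sequences_component[OF X f AB(2)] by (intro closed_INT) auto
    ultimately show ?thesis
      using compact_imp_closed[OF compact_sequences[OF X]] by (simp add: closed_Int)
  qed
  have fip: "?T \<inter> (\<Inter>i\<in>I. Z i) \<noteq> {}" if I: "finite I" for I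
  proof -
    obtain n where n: "\<forall>i\<in>I. i < n"
      using I finite_nat_set_iff_bounded by auto
    obtain x where "\<forall>j. x j \<in> X" "\<forall>i<n. cond i x"
      using fin'[of n] by auto
    then have "x \<in> ?T \<inter> (\<Inter>i\<in>I. Z i)"
      using n by (simp add: Z_def)
    then show ?thesis
      by blast
  qed
  have "?T \<inter> (\<Inter>i\<in>UNIV. Z i) \<noteq> {}"
    by (rule compact_imp_fip_image[OF compact_sequences[OF X]]) (rule closed_Z, rule fip)
  then obtain x where "\<forall>j. x j \<in> X" "\<forall>i. cond i x"
    by (auto simp: Z_def)
  then show ?thesis
    unfolding cond_def by (intro exI[of _ x] conjI) simp_all
qed

text \<open>This is the image under \<open>\<lambda>x. \<pi> (x 0)\<close> of the sequences that
  stay in one fibre and satisfy the separation inequalities. The latter are not strict, hence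
  closed.\<close>

lemma compact_separated_tuples:
  fixes \<pi> :: "'x::metric_space \<Rightarrow> 'h::metric_space"
  assumes "compact X" "continuous_on X \<pi>"
  shows "compact {h. \<exists>x :: nat \<Rightarrow> 'x. (\<forall>j. x j \<in> X \<and> \<pi> (x j) = h) \<and> (\<forall>i<n. \<forall>j<i. dist (x i) (x j) \<ge> e)}"
proof -
  let ?T = "{x :: nat \<Rightarrow> 'x. \<forall>j. x j \<in> X}"
  have cont: "continuous_on ?T (\<lambda>x. \<pi> (x j))" for j
    by (rule continuous_on_compose2[OF assms(2)]) (auto intro: continuous_on_subset[OF continuous_on_product_coordinates])
  have cT: "closed ?T"
    by (intro compact_imp_closed compact_sequences assms(1))
  have 1: "closed (?T \<inter> (\<lambda>x. dist (\<pi> (x j)) (\<pi> (x 0))) -` {0})" for j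
    by (intro continuous_closed_preimage cT continuous_intros cont closed_singleton)
  have 2: "closed (?T \<inter> (\<lambda>x. dist (x i) (x j)) -` {e..})" for i j
    by (intro continuous_closed_preimage cT continuous_intros
        continuous_on_subset[OF continuous_on_product_coordinates] closed_atLeast) auto
  have C1: "closed (\<Inter>j. ?T \<inter> (\<lambda>x. dist (\<pi> (x j)) (\<pi> (x 0))) -` {0})" (is "closed ?C1")
    by (rule closed_INT) (use 1 in blast)
  have C2: "closed (\<Inter>(i, j)\<in>{(i, j). i < n \<and> j < i}. ?T \<inter> (\<lambda>x. dist (x i) (x j)) -` {e..})" (is "closed ?C2")
    by (rule closed_INT) (use 2 in force)
  define S where "S = (?T \<inter> ?C1) \<inter> ?C2"
  have "compact S"
    unfolding S_def by (rule compact_Int_closed[OF compact_Int_closed[OF compact_sequences[OF assms(1)] C1] C2])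
  moreover have "continuous_on S (\<lambda>x. \<pi> (x 0))"
    using cont[of 0] by (rule continuous_on_subset) (auto simp: S_def)
  ultimately have "compact ((\<lambda>x. \<pi> (x 0)) ` S)"
    by (intro compact_continuous_image)
  moreover have "(\<lambda>x. \<pi> (x 0)) ` S = {h. \<exists>x :: nat \<Rightarrow> 'x. (\<forall>j. x j \<in> X \<and> \<pi> (x j) = h) \<and> (\<forall>i<n. \<forall>j<i. dist (x i) (x j) \<ge> e)}"
  proof (intro subset_antisym subsetI)
    fix h assume "h \<in> {h. \<exists>x :: nat \<Rightarrow> 'x. (\<forall>j. x j \<in> X \<and> \<pi> (x j) = h) \<and> (\<forall>i<n. \<forall>j<i. dist (x i) (x j) \<ge> e)}"
    then obtain x :: "nat \<Rightarrow> 'x" where x: "\<forall>j. x j \<in> X \<and> \<pi> (x j) = h" "\<forall>i<n. \<forall>j<i. dist (x i) (x j) \<ge> e"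
      by blast
    then have "x \<in> S" "h = \<pi> (x 0)"
      by (auto simp: S_def)
    then show "h \<in> (\<lambda>x. \<pi> (x 0)) ` S"
      by blast
  next
    fix h assume "h \<in> (\<lambda>x. \<pi> (x 0)) ` S"
    then obtain x where "x \<in> S" and h: "h = \<pi> (x 0)"
      by blast
    then have "\<forall>j. x j \<in> X \<and> \<pi> (x j) = h" "\<forall>i<n. \<forall>j<i. dist (x i) (x j) \<ge> e"
      by (auto simp: S_def)
    then show "h \<in> {h. \<exists>x :: nat \<Rightarrow> 'x. (\<forall>j. x j \<in> X \<and> \<pi> (x j) = h) \<and> (\<forall>i<n. \<forall>j<i. dist (x i) (x j) \<ge> e)}"
      by blast
  qed
  ultimately show ?thesis
    by simp
qed

section \<open>The maximal equicontinuous factor\<close>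

lemma finite_set_separation:
  fixes S :: "'a::metric_space set"
  assumes "finite S"
  obtains e where "e > 0" "\<And>x y. x \<in> S \<Longrightarrow> y \<in> S \<Longrightarrow> x \<noteq> y \<Longrightarrow> e \<le> dist x y"
proof -
  define D where "D = insert 1 ((\<lambda>(x, y). dist x y) ` {(x, y) \<in> S \<times> S. x \<noteq> y})"
  have fin: "finite D"
    using assms unfolding D_def by (intro finite.insertI finite_imageI) (auto intro: finite_subset[of _ "S \<times> S"])
  show thesis
  proof (rule that[of "Min D"])
    show "Min D > 0"
      using fin by (subst Min_gr_iff) (auto simp: D_def)
    show "Min D \<le> dist x y" if "x \<in> S" "y \<in> S" "x \<noteq> y" for x y
      using that by (intro Min_le fin) (auto simp: D_def)
  qed
qed

text \<open>The definition of S_eq supplies equicontinuity for some metric d on the set of classes,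
  whereas the averaging arguments need it for the metric of H. On compact spaces the property does
  not depend on the metric; the comparison runs through sequences in X.\<close>

lemma equicontinuous_max_factor:
  assumes sys: "G_system act X" and fac: "max_equicontinuous_factor act X actH H \<pi>" and "e > 0"
  shows "\<exists>\<delta>>0. \<forall>g. \<forall>x\<in>H. \<forall>y\<in>H. dist x y < \<delta> \<longrightarrow> dist (actH g x) (actH g y) < e"
proof (rule ccontr)
  assume neg: "\<not> ?thesis"
  have X: "compact X" "\<And>g x. x \<in> X \<Longrightarrow> act g x \<in> X"
    and inv: "\<And>g x. x \<in> X \<Longrightarrow> act (- g) (act g x) = x" "\<And>g x. x \<in> X \<Longrightarrow> act g (act (- g) x) = x"
  proof -
    show "compact X" "\<And>g x. x \<in> X \<Longrightarrow> act g x \<in> X"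
      using sys unfolding G_system_def by blast+
    fix g x assume "x \<in> X"
    then have "act (- g + g) x = act (- g) (act g x)" "act (g + - g) x = act g (act (- g) x)" "act 0 x = x"
      using sys unfolding G_system_def by blast+
    then show "act (- g) (act g x) = x" "act g (act (- g) x) = x"
      by auto
  qed
  define R where "R = {(x, y). x \<in> X \<and> y \<in> X \<and> \<pi> x = \<pi> y}"
  have \<pi>: "continuous_on X \<pi>" "\<pi> ` X = H" "\<And>g x. x \<in> X \<Longrightarrow> \<pi> (act g x) = actH g (\<pi> x)"
    and S: "is_S_eq act X R"
    using fac unfolding max_equicontinuous_factor_def R_def by auto
  have "quotient_equicontinuous act X R"
    using S unfolding is_S_eq_def eqc_relation_def by blast
  then obtain d where d: "Metric_space (X//R) d"
    "\<forall>U. openin (Metric_space.mtopology (X//R) d) U \<longleftrightarrow> U \<subseteq> X//R \<and> openin (top_of_set X) (\<Union>U)"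
    "\<forall>e>0. \<exists>\<delta>>0. \<forall>g. \<forall>C\<in>X//R. \<forall>D\<in>X//R. d C D < \<delta> \<longrightarrow> d (act g ` C) (act g ` D) < e"
    unfolding quotient_equicontinuous_def by blast
  interpret Q: Metric_space "X//R" d by (rule d(1))
  define cl where "cl x = R `` {x}" for x
  have cl_in: "cl x \<in> X//R" if "x \<in> X" for x
    using that by (auto simp: cl_def quotient_def)
  have cl_eq: "cl x = {y \<in> X. \<pi> y = \<pi> x}" if "x \<in> X" for x
    using that by (auto simp: cl_def R_def)
  have cl_eq_iff: "cl x = cl y \<longleftrightarrow> \<pi> x = \<pi> y" if "x \<in> X" "y \<in> X" for x y
    using that by (auto simp: cl_eq)
  have cl_act: "act g ` cl x = cl (act g x)" if x: "x \<in> X" for g x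
  proof (intro subset_antisym subsetI)
    fix y assume "y \<in> act g ` cl x"
    then show "y \<in> cl (act g x)"
      using x X(2) \<pi>(3) by (auto simp: cl_eq)
  next
    fix y assume "y \<in> cl (act g x)"
    then have y: "y \<in> X" "\<pi> y = \<pi> (act g x)"
      using x X(2) by (auto simp: cl_eq)
    have "\<pi> (act (- g) y) = actH (- g) (\<pi> (act g x))"
      using y \<pi>(3) by simp
    also have "\<dots> = \<pi> x"
      using x inv(1) X(2) \<pi>(3) by metis
    finally have "act (- g) y \<in> cl x"
      using x y X(2) by (simp add: cl_eq)
    then show "y \<in> act g ` cl x"
      using inv(2)[OF y(1), of g] by (metis imageI)
  qed
  \<comment> \<open>The quotient topology ties d to X: the union of the classes in a d-ball is open
    in X, so it eventually contains the sequence, and it is saturated.\<close>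
  have cl_tendsto: "(\<lambda>n. d (cl (f n)) (cl l)) \<longlonglongrightarrow> 0"
    if f: "\<And>n. f n \<in> X" and l: "l \<in> X" and lim: "f \<longlonglongrightarrow> l" for f :: "nat \<Rightarrow> 'b" and l
  proof (rule tendstoI)
    fix \<epsilon> :: real assume "\<epsilon> > 0"
    let ?U = "Q.mball (cl l) \<epsilon>"
    have "openin (top_of_set X) (\<Union>?U)"
      using d(2) Q.openin_mball by blast
    then obtain V where V: "open V" "\<Union>?U = X \<inter> V"
      by (auto simp: openin_open)
    have "cl l \<in> ?U"
      using cl_in[OF l] \<open>\<epsilon> > 0\<close> by simp
    then have "l \<in> V"
      using V(2) cl_eq[OF l] l by blast
    then have "\<forall>\<^sub>F n in sequentially. f n \<in> V"
      using lim V(1) by (rule topological_tendstoD[rotated 2])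
    then show "\<forall>\<^sub>F n in sequentially. dist (d (cl (f n)) (cl l)) 0 < \<epsilon>"
    proof eventually_elim
      case (elim n)
      then obtain C where C: "C \<in> ?U" "f n \<in> C"
        using V(2) f by blast
      have "C \<in> X//R"
        using C(1) Q.in_mball by blast
      then obtain z where z: "z \<in> X" "C = cl z"
        unfolding cl_def by (rule quotientE)
      have "\<pi> (f n) = \<pi> z"
        using C(2) unfolding z(2) cl_eq[OF z(1)] by blast
      then have "C = cl (f n)"
        using z f cl_eq_iff by auto
      then show ?case
        using C(1) Q.commute[of "cl l" "cl (f n)"] Q.nonneg by (auto simp: dist_real_def)
    qed
  qed
  \<comment> \<open>Failure of equicontinuity on H is lifted to X, where points and their translates
    all have convergent subsequences.\<close>
  have "\<exists>g x y. x \<in> X \<and> y \<in> X \<and> dist (\<pi> x) (\<pi> y) < inverse (Suc n) \<and> dist (\<pi> (act g x)) (\<pi> (act g y)) \<ge> e" for n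
  proof -
    have "inverse (real (Suc n)) > 0"
      by simp
    then obtain g h h' where "h \<in> H" "h' \<in> H" "dist h h' < inverse (Suc n)" "\<not> dist (actH g h) (actH g h') < e"
      using neg by blast
    moreover obtain x y where "x \<in> X" "y \<in> X" "h = \<pi> x" "h' = \<pi> y"
      using \<open>h \<in> H\<close> \<open>h' \<in> H\<close> \<pi>(2) by blast
    ultimately show ?thesis
      using \<pi>(3) by (intro exI[of _ g] exI[of _ x] exI[of _ y]) auto
  qed
  then obtain g x y where xy: "\<And>n. x n \<in> X" "\<And>n. y n \<in> X"
    "\<And>n. dist (\<pi> (x n)) (\<pi> (y n)) < inverse (Suc n)"
    "\<And>n. dist (\<pi> (act (g n) (x n))) (\<pi> (act (g n) (y n))) \<ge> e"
    by metis
  have "seq_compact (X \<times> X \<times> X \<times> X)"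
    using X(1) by (intro compact_imp_seq_compact compact_Times)
  then obtain l r where l: "l \<in> X \<times> X \<times> X \<times> X" and r: "strict_mono (r :: nat \<Rightarrow> nat)"
    and "((\<lambda>n. (x n, y n, act (g n) (x n), act (g n) (y n))) \<circ> r) \<longlonglongrightarrow> l"
    by (rule seq_compactE[where f = "\<lambda>n. (x n, y n, act (g n) (x n), act (g n) (y n))"]) (use xy X(2) in auto)
  then obtain a a' b b' where mem: "a \<in> X" "a' \<in> X" "b \<in> X" "b' \<in> X"
    and lim: "(\<lambda>n. (x (r n), y (r n), act (g (r n)) (x (r n)), act (g (r n)) (y (r n)))) \<longlonglongrightarrow> (a, a', b, b')"
    by (cases l) (auto simp: o_def)
  have lims: "(\<lambda>n. x (r n)) \<longlonglongrightarrow> a" "(\<lambda>n. y (r n)) \<longlonglongrightarrow> a'"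
    "(\<lambda>n. act (g (r n)) (x (r n))) \<longlonglongrightarrow> b" "(\<lambda>n. act (g (r n)) (y (r n))) \<longlonglongrightarrow> b'"
    using tendsto_fst[OF lim] tendsto_fst[OF tendsto_snd[OF lim]]
      tendsto_fst[OF tendsto_snd[OF tendsto_snd[OF lim]]] tendsto_snd[OF tendsto_snd[OF tendsto_snd[OF lim]]]
    by simp_all
  have \<pi>_lim: "(\<lambda>n. \<pi> (f n)) \<longlonglongrightarrow> \<pi> l" if "\<And>n. f n \<in> X" "l \<in> X" "f \<longlonglongrightarrow> l" for f :: "nat \<Rightarrow> 'b" and l
    using continuous_on_tendsto_compose[OF \<pi>(1) that(3) that(2)] that(1) by simp
  have "(\<lambda>n. dist (\<pi> (x (r n))) (\<pi> (y (r n)))) \<longlonglongrightarrow> dist (\<pi> a) (\<pi> a')"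
    by (intro tendsto_dist \<pi>_lim xy mem lims)
  moreover have "(\<lambda>n. dist (\<pi> (x (r n))) (\<pi> (y (r n)))) \<longlonglongrightarrow> 0"
  proof (rule tendsto_sandwich[OF _ _ tendsto_const])
    show "(\<lambda>n. inverse (real (Suc (r n)))) \<longlonglongrightarrow> 0"
      using LIMSEQ_subseq_LIMSEQ[OF LIMSEQ_inverse_real_of_nat r] by (simp add: o_def)
    show "\<forall>\<^sub>F n in sequentially. dist (\<pi> (x (r n))) (\<pi> (y (r n))) \<le> inverse (real (Suc (r n)))"
      using xy(3) by (intro always_eventually allI less_imp_le)
  qed auto
  ultimately have "\<pi> a = \<pi> a'"
    using LIMSEQ_unique by fastforce
  then have cl_a: "cl a = cl a'"
    using mem cl_eq_iff by blast
  have "(\<lambda>n. dist (\<pi> (act (g (r n)) (x (r n)))) (\<pi> (act (g (r n)) (y (r n))))) \<longlonglongrightarrow> dist (\<pi> b) (\<pi> b')"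
    by (intro tendsto_dist \<pi>_lim xy mem lims X(2))
  then have "dist (\<pi> b) (\<pi> b') \<ge> e"
    by (rule LIMSEQ_le_const) (use xy(4) in blast)
  then have "cl b \<noteq> cl b'"
    using \<open>e > 0\<close> mem cl_eq_iff by fastforce
  \<comment> \<open>The limits satisfy \<open>cl a = cl a'\<close> but
    \<open>cl b \<noteq> cl b'\<close>. Equicontinuity keeps the translated classes within \<eta>/3
    of each other, and each is within \<eta>/3 of its limit, so \<open>cl b\<close> and
    \<open>cl b'\<close> would be closer than \<eta>.\<close>
  define \<eta> where "\<eta> = d (cl b) (cl b')"
  have "\<eta> > 0"
    using \<open>cl b \<noteq> cl b'\<close> Q.mdist_pos_less cl_in mem unfolding \<eta>_def by blast
  then obtain \<delta> where \<delta>: "\<delta> > 0"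
    "\<And>g C D. C \<in> X//R \<Longrightarrow> D \<in> X//R \<Longrightarrow> d C D < \<delta> \<Longrightarrow> d (act g ` C) (act g ` D) < \<eta> / 3"
    using d(3)[rule_format, of "\<eta> / 3"] by auto
  have ev: "\<forall>\<^sub>F n in sequentially. d (cl (f n)) (cl l) < c"
    if "\<And>n. f n \<in> X" "l \<in> X" "f \<longlonglongrightarrow> l" "c > 0" for f :: "nat \<Rightarrow> 'b" and l c
    by (rule order_tendstoD(2)[OF cl_tendsto[OF that(1-3)] that(4)])
  have "\<forall>\<^sub>F n in sequentially. d (cl (x (r n))) (cl a) < \<delta> / 2 \<and> d (cl (y (r n))) (cl a') < \<delta> / 2 \<and>
     d (cl (act (g (r n)) (x (r n)))) (cl b) < \<eta> / 3 \<and> d (cl (act (g (r n)) (y (r n)))) (cl b') < \<eta> / 3"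
    by (intro eventually_conj ev xy mem lims X(2)) (use \<open>\<eta> > 0\<close> \<delta>(1) in auto)
  then obtain n where n: "d (cl (x (r n))) (cl a) < \<delta> / 2" "d (cl (y (r n))) (cl a') < \<delta> / 2"
     "d (cl (act (g (r n)) (x (r n)))) (cl b) < \<eta> / 3" "d (cl (act (g (r n)) (y (r n)))) (cl b') < \<eta> / 3"
    by (auto simp: eventually_sequentially)
  have in_Q: "cl (x (r n)) \<in> X//R" "cl (y (r n)) \<in> X//R" "cl a \<in> X//R" "cl b \<in> X//R" "cl b' \<in> X//R"
    "cl (act (g (r n)) (x (r n))) \<in> X//R" "cl (act (g (r n)) (y (r n))) \<in> X//R"
    by (auto intro!: cl_in xy mem X(2))
  have "d (cl (x (r n))) (cl (y (r n))) \<le> d (cl (x (r n))) (cl a) + d (cl a) (cl (y (r n)))"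
    by (rule Q.triangle) (rule in_Q)+
  then have "d (cl (x (r n))) (cl (y (r n))) < \<delta>"
    using n(1,2) cl_a Q.commute[of "cl a'" "cl (y (r n))"] by simp
  then have "d (act (g (r n)) ` cl (x (r n))) (act (g (r n)) ` cl (y (r n))) < \<eta> / 3"
    by (rule \<delta>(2)[OF in_Q(1,2)])
  then have small: "d (cl (act (g (r n)) (x (r n)))) (cl (act (g (r n)) (y (r n)))) < \<eta> / 3"
    by (simp add: cl_act xy)
  have "\<eta> \<le> d (cl b) (cl (act (g (r n)) (x (r n)))) + d (cl (act (g (r n)) (x (r n)))) (cl b')"
    unfolding \<eta>_def by (rule Q.triangle) (rule in_Q)+
  moreover have "d (cl (act (g (r n)) (x (r n)))) (cl b') \<le>
     d (cl (act (g (r n)) (x (r n)))) (cl (act (g (r n)) (y (r n)))) + d (cl (act (g (r n)) (y (r n)))) (cl b')"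
    by (rule Q.triangle) (rule in_Q)+
  ultimately show False
    using small n(3,4) Q.commute[of "cl b" "cl (act (g (r n)) (x (r n)))"] by simp
qed

lemma minimal_factor_system:
  assumes sys: "G_system act X" "minimal_system act X" and H: "G_system actH H" 
    and \<pi>: "continuous_on X \<pi>" "\<pi> ` X = H" "\<And>g x. x \<in> X \<Longrightarrow> \<pi> (act g x) = actH g (\<pi> x)"
  shows "minimal_system actH H"
  unfolding minimal_system_def
proof (intro ballI subsetI)
  fix h k assume "h \<in> H" "k \<in> H"
  then obtain x y where x: "x \<in> X" "h = \<pi> x" and y: "y \<in> X" "k = \<pi> y"
    using \<pi>(2) by blast
  have orb: "range (\<lambda>g. act g x) \<subseteq> X"
    using sys(1) x(1) unfolding G_system_def by blast
  have cX: "closure (range (\<lambda>g. act g x)) \<subseteq> X"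
    using orb sys(1) unfolding G_system_def by (meson closure_minimal compact_imp_closed)
  have "y \<in> closure (range (\<lambda>g. act g x))"
    using sys(2) x(1) y(1) unfolding minimal_system_def by blast
  then have "k \<in> \<pi> ` closure (range (\<lambda>g. act g x))"
    using y(2) by blast
  also have "\<dots> \<subseteq> closure (range (\<lambda>g. actH g h))"
  proof (rule image_closure_subset)
    show "continuous_on (closure (range (\<lambda>g. act g x))) \<pi>"
      using \<pi>(1) cX by (rule continuous_on_subset)
    show "\<pi> ` range (\<lambda>g. act g x) \<subseteq> closure (range (\<lambda>g. actH g h))"
      using \<pi>(3)[OF x(1)] x(2) closure_subset[of "range (\<lambda>g. actH g h)"] by auto
  qed simp
  finally show "k \<in> closure (range (\<lambda>g. actH g h))" .
qed

section \<open>Fibre cardinalities\<close>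

locale minimal_factor =
  X: minimal_G_system act X + H: minimal_G_system actH H
  for act :: "'g::group_add \<Rightarrow> 'x::metric_space \<Rightarrow> 'x" and X
    and actH :: "'g \<Rightarrow> 'h::metric_space \<Rightarrow> 'h" and H +
  fixes \<pi> :: "'x \<Rightarrow> 'h"
  assumes continuous: "continuous_on X \<pi>" and image: "\<pi> ` X = H"
    and equivariant: "x \<in> X \<Longrightarrow> \<pi> (act g x) = actH g (\<pi> x)"
    and countable_group: "countable (UNIV :: 'g set)"
    and nonempty: "H \<noteq> {}"
begin

definition fiber :: "'h \<Rightarrow> 'x set" where
  "fiber h = {x \<in> X. \<pi> x = h}"

text \<open>Infinite fibres are listed separately because \<open>card\<close> sends them to
  0.\<close>

definition fiber_card_ge :: "nat \<Rightarrow> 'h \<Rightarrow> bool" where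
  "fiber_card_ge n h \<longleftrightarrow> infinite (fiber h) \<or> n \<le> card (fiber h)"

text \<open>For n > 0 the choices e = 1/(k + 1) exhaust the fibres with at least n points by
  countably many closed sets, which serves both the Baire argument and measurability.\<close>

definition separated :: "nat \<Rightarrow> real \<Rightarrow> 'h set" where
  "separated n e = {h. \<exists>x :: nat \<Rightarrow> 'x. (\<forall>j. x j \<in> X \<and> \<pi> (x j) = h) \<and> (\<forall>i<n. \<forall>j<i. dist (x i) (x j) \<ge> e)}"

lemma fiber_card_eq_iff: "fiber_card_eq X \<pi> h K \<longleftrightarrow> finite (fiber h) \<and> card (fiber h) = K"
  by (simp add: fiber_card_eq_def fiber_def)

lemma separated_subset: "separated n e \<subseteq> H"
proof
  fix h assume "h \<in> separated n e"
  then obtain x :: "nat \<Rightarrow> 'x" where "\<forall>j. x j \<in> X \<and> \<pi> (x j) = h"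
    unfolding separated_def by blast
  then have "x 0 \<in> X" "\<pi> (x 0) = h"
    by auto
  then show "h \<in> H"
    using image by blast
qed

lemma closedin_separated: "closedin (top_of_set H) (separated n e)"
proof -
  have "closed (separated n e)"
    unfolding separated_def by (intro compact_imp_closed compact_separated_tuples X.compact continuous)
  then show ?thesis
    using separated_subset by (simp add: closed_subset)
qed

lemma separated_imp_fiber_card_ge:
  assumes "h \<in> separated n e" "e > 0"
  shows "fiber_card_ge n h"
proof -
  obtain x :: "nat \<Rightarrow> 'x" where x: "\<And>j. x j \<in> X \<and> \<pi> (x j) = h" "\<And>i j. i < n \<Longrightarrow> j < i \<Longrightarrow> dist (x i) (x j) \<ge> e"
    using assms(1) unfolding separated_def by blast
  have "inj_on x {..<n}"
  proof (rule linorder_inj_onI')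
    fix i j assume "i < j" "j \<in> {..<n}"
    then show "x i \<noteq> x j"
      using x(2)[of j i] \<open>e > 0\<close> by auto
  qed
  moreover have "x ` {..<n} \<subseteq> fiber h"
    using x(1) by (auto simp: fiber_def)
  ultimately show ?thesis
    unfolding fiber_card_ge_def using card_inj_on_le[of x "{..<n}" "fiber h"] by auto
qed

lemma fiber_card_ge_subset:
  assumes "fiber_card_ge n h"
  obtains S where "S \<subseteq> fiber h" "finite S" "card S = n"
  using assms infinite_arbitrarily_large obtain_subset_with_card_n unfolding fiber_card_ge_def
  by metis

lemma fiber_card_ge_imp_separated:
  assumes "fiber_card_ge n h" "n > 0"
  obtains k where "h \<in> separated n (inverse (Suc k))"
proof -
  obtain S where S: "S \<subseteq> fiber h" "finite S" "card S = n"
    using fiber_card_ge_subset[OF assms(1)] by blast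
  obtain y where y: "bij_betw y {..<n} S"
    using ex_bij_betw_nat_finite[OF S(2)] S(3) by (auto simp: atLeast0LessThan)
  obtain e where e: "e > 0" "\<And>x y. x \<in> S \<Longrightarrow> y \<in> S \<Longrightarrow> x \<noteq> y \<Longrightarrow> e \<le> dist x y"
    using finite_set_separation[OF S(2)] by blast
  obtain k where k: "inverse (Suc k) < e"
    using reals_Archimedean[OF e(1)] by blast
  \<comment> \<open>Entries from n on repeat \<open>y 0\<close>, since all entries have to lie in
    the fibre; n > 0 ensures that \<open>y 0\<close> does.\<close>
  define x where "x j = y (if j < n then j else 0)" for j
  have "x j \<in> S" for j
    using y assms(2) unfolding x_def bij_betw_def by auto
  then have "\<forall>j. x j \<in> X \<and> \<pi> (x j) = h"
    using S(1) by (auto simp: fiber_def)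
  moreover have "dist (x i) (x j) \<ge> inverse (Suc k)" if "i < n" "j < i" for i j
  proof -
    have "j < n"
      using that by simp
    then have "y i \<in> S" "y j \<in> S" "y i \<noteq> y j"
      using y that by (auto simp: bij_betw_def inj_on_eq_iff)
    then have "e \<le> dist (y i) (y j)"
      by (rule e(2))
    then show ?thesis
      using k that by (simp add: x_def)
  qed
  ultimately have "h \<in> separated n (inverse (Suc k))"
    unfolding separated_def by blast
  then show thesis
    by (rule that)
qed

lemma fiber_card_ge_act:
  assumes "fiber_card_ge n (actH g h)" "h \<in> H"
  shows "fiber_card_ge n h"
proof -
  have "act (- g) ` fiber (actH g h) \<subseteq> fiber h"
    using assms(2) equivariant X.act_in H.act_uminus_act by (auto simp: fiber_def)
  moreover have "inj_on (act (- g)) (fiber (actH g h))"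
    by (rule inj_on_inverseI[of _ "act g"]) (simp add: fiber_def X.act_act_uminus)
  ultimately show ?thesis
    using assms(1) unfolding fiber_card_ge_def by (meson card_inj_on_le inj_on_finite order.trans)
qed

text \<open>The fibres with fewer than K points form an invariant set, the complement of a countable
  union of closed sets. If it were nonempty, these closed sets would have empty interior,
  contradicting that their union is residual.\<close>

lemma residual_fiber_card_ge:
  assumes res: "residual_in H {h \<in> H. fiber_card_ge K h}" and "K > 0" and h: "h \<in> H"
  shows "fiber_card_ge K h"
proof (rule ccontr)
  assume small: "\<not> fiber_card_ge K h"
  obtain D where D: "D \<subseteq> {h \<in> H. fiber_card_ge K h}" "gdelta_in (top_of_set H) D" "H \<subseteq> closure D"
    using res unfolding residual_in_def by blast
  obtain \<U> where U: "countable \<U>" "\<And>U. U \<in> \<U> \<Longrightarrow> openin (top_of_set H) U" "\<Inter>\<U> = D"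
    using D(2) unfolding gdelta_in_alt intersection_of_def by auto
  \<comment> \<open>A countable closed cover of H: the first family covers D, the second its
    complement. A member of the first with interior would be entered by the orbit of h, and its K
    fibre points could be moved back over h; a member of the second with interior would meet the
    dense set D.\<close>
  define \<G> where "\<G> = range (\<lambda>k. separated K (inverse (Suc k))) \<union> (\<lambda>U. H - U) ` \<U>"
  have "H \<subseteq> \<Union>\<G>"
  proof
    fix x assume x: "x \<in> H"
    show "x \<in> \<Union>\<G>"
    proof (cases "x \<in> D")
      case True
      then obtain k where "x \<in> separated K (inverse (Suc k))"
        using D(1) fiber_card_ge_imp_separated[OF _ \<open>K > 0\<close>] by blast
      then show ?thesis
        unfolding \<G>_def by blast
    next
      case False
      then show ?thesis
        using x U(3) unfolding \<G>_def by blast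
    qed
  qed
  moreover have "countable \<G>"
    using U(1) by (simp add: \<G>_def)
  moreover have "closedin (top_of_set H) T" if "T \<in> \<G>" for T
    using that closedin_separated U(2) unfolding \<G>_def by (auto intro: openin_closedin_eq[THEN iffD1, THEN conjunct2] simp: closedin_diff)
  ultimately obtain T where T: "T \<in> \<G>" "top_of_set H interior_of T \<noteq> {}"
    using H.Baire[of \<G>] nonempty by blast
  have op: "openin (top_of_set H) (top_of_set H interior_of T)"
    by simp
  consider k where "T = separated K (inverse (Suc k))" | U where "U \<in> \<U>" "T = H - U"
    using T(1) unfolding \<G>_def by blast
  then show False
  proof cases
    case 1
    obtain g where "actH g h \<in> top_of_set H interior_of T"
      by (rule H.visits_openin[OF h op T(2)])
    then have "actH g h \<in> separated K (inverse (Suc k))"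
      using interior_of_subset[of "top_of_set H" T] 1 by blast
    then have "fiber_card_ge K (actH g h)"
      by (rule separated_imp_fiber_card_ge) simp
    then show False
      using fiber_card_ge_act[OF _ h] small by blast
  next
    case 2
    obtain V where V: "open V" "top_of_set H interior_of T = H \<inter> V"
      using op unfolding openin_open by blast
    then have "V \<inter> closure D \<noteq> {}"
      using T(2) D(3) by blast
    then have "V \<inter> D \<noteq> {}"
      using V(1) by (metis open_Int_closure_eq_empty)
    then obtain x where "x \<in> V" "x \<in> D"
      by blast
    then have "x \<in> T"
      using V(2) D(1) interior_of_subset[of "top_of_set H" T] by blast
    then show False
      using 2 U(3) \<open>x \<in> D\<close> by blast
  qed
qed

text \<open>By minimality the preimages of a small ball under group elements cover X, so those of
  its image cover H. As the group is countable, Baire gives one of them interior. A closed ball is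
  used because its image is compact, hence closed.\<close>

lemma interior_of_image_open_nonempty:
  assumes "open U" "X \<inter> U \<noteq> {}"
  shows "top_of_set H interior_of (\<pi> ` (X \<inter> U)) \<noteq> {}"
proof -
  obtain x where x: "x \<in> X" "x \<in> U"
    using assms(2) by blast
  obtain e where e: "e > 0" "cball x e \<subseteq> U"
    using assms(1) x(2) by (meson open_contains_cball)
  define C where "C = \<pi> ` (X \<inter> cball x e)"
  have "compact C"
    unfolding C_def
    by (intro compact_continuous_image continuous_on_subset[OF continuous] compact_Int_closed X.compact) auto
  then have C: "closedin (top_of_set H) C"
    using image by (auto simp: C_def intro!: closed_subset compact_imp_closed)
  have "H \<subseteq> \<Union>(range (\<lambda>g. {h \<in> H. actH g h \<in> C}))"
  proof
    fix h assume "h \<in> H"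
    then obtain z where z: "z \<in> X" "h = \<pi> z"
      using image by blast
    obtain g where "act g z \<in> ball x e"
      using X.visits_open[OF z(1), of "ball x e"] x(1) e(1) by (metis IntI centre_in_ball empty_iff open_ball)
    then have "actH g h \<in> C"
      using z X.act_in equivariant unfolding C_def by (auto simp flip: equivariant)
    then show "h \<in> \<Union>(range (\<lambda>g. {h \<in> H. actH g h \<in> C}))"
      using \<open>h \<in> H\<close> by blast
  qed
  moreover have "countable (range (\<lambda>g. {h \<in> H. actH g h \<in> C}))"
    using countable_group by simp
  moreover have "closedin (top_of_set H) T" if "T \<in> range (\<lambda>g. {h \<in> H. actH g h \<in> C})" for T
    using that H.closedin_vimage_act[OF C] by blast
  ultimately obtain g where "top_of_set H interior_of {h \<in> H. actH g h \<in> C} \<noteq> {}"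
    using H.Baire[of "range (\<lambda>g. {h \<in> H. actH g h \<in> C})", OF _ _ _ nonempty] by (metis (no_types, lifting) rangeE)
  then have "top_of_set H interior_of C \<noteq> {}"
    by (rule H.interior_of_vimage_act)
  moreover have "C \<subseteq> \<pi> ` (X \<inter> U)"
    using e(2) by (auto simp: C_def)
  ultimately show ?thesis
    using interior_of_mono[of C "\<pi> ` (X \<inter> U)" "top_of_set H"] by blast
qed

section \<open>Base points whose fibres meet or avoid a ball\<close>

definition hit :: "'x \<Rightarrow> real \<Rightarrow> 'h set" where
  "hit q e = top_of_set H interior_of (\<pi> ` (X \<inter> ball q e))"

definition miss :: "'x \<Rightarrow> real \<Rightarrow> 'h set" where
  "miss q e = H - \<pi> ` (X \<inter> cball q e)"

lemma hit_subset: "hit q e \<subseteq> \<pi> ` (X \<inter> ball q e)"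
  unfolding hit_def by (rule interior_of_subset)

lemma openin_hit: "openin (top_of_set H) (hit q e)"
  by (simp add: hit_def)

lemma openin_miss: "openin (top_of_set H) (miss q e)"
proof -
  have "compact (\<pi> ` (X \<inter> cball q e))"
    by (intro compact_continuous_image continuous_on_subset[OF continuous] compact_Int_closed X.compact) auto
  then have "closedin (top_of_set H) (\<pi> ` (X \<inter> cball q e))"
    using image by (auto intro!: closed_subset compact_imp_closed)
  then show ?thesis
    unfolding miss_def by (simp add: openin_diff)
qed

text \<open>Passing to the interior in \<open>hit\<close> loses nothing up to closure: every
  neighbourhood of x inside the ball already has an image with interior, and these images shrink to
  \<pi> x.\<close>

lemma closure_hit:
  assumes x: "x \<in> X" "x \<in> ball q e"
  shows "\<pi> x \<in> closure (hit q e)"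
  unfolding closure_iff_nhds_not_empty
proof (intro allI impI)
  fix A V assume V: "V \<subseteq> A" "open V" "\<pi> x \<in> V"
  have "openin (top_of_set X) (X \<inter> \<pi> -` V)"
    using continuous V(2) by (rule continuous_openin_preimage_gen)
  then obtain W where W: "open W" "X \<inter> \<pi> -` V = X \<inter> W"
    by (auto simp: openin_open)
  have "x \<in> X \<inter> W"
    unfolding W(2)[symmetric] using x(1) V(3) by simp
  then have "X \<inter> (W \<inter> ball q e) \<noteq> {}"
    using x by blast
  then have ne: "top_of_set H interior_of (\<pi> ` (X \<inter> (W \<inter> ball q e))) \<noteq> {}"
    by (intro interior_of_image_open_nonempty) (auto simp: W(1))
  have "top_of_set H interior_of (\<pi> ` (X \<inter> (W \<inter> ball q e))) \<subseteq> hit q e"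
    unfolding hit_def by (rule interior_of_mono) blast
  moreover have "\<pi> ` (X \<inter> (W \<inter> ball q e)) \<subseteq> V"
    using W(2) by blast
  then have "top_of_set H interior_of (\<pi> ` (X \<inter> (W \<inter> ball q e))) \<subseteq> V"
    using interior_of_subset[of "top_of_set H" "\<pi> ` (X \<inter> (W \<inter> ball q e))"] by blast
  ultimately show "hit q e \<inter> A \<noteq> {}"
    using ne V(1) by blast
qed

text \<open>Fibres over points near b with only K points cannot come near all points of a larger set S
  in the fibre over b.\<close>

lemma closure_miss:
  assumes D: "H \<subseteq> closure D" "\<And>h. h \<in> D \<Longrightarrow> finite (fiber h) \<and> card (fiber h) = K"
    and b: "b \<in> H" and S: "finite S" "card S > K" "S \<subseteq> fiber b" and "e > 0"
    and sep: "\<And>x y. x \<in> S \<Longrightarrow> y \<in> S \<Longrightarrow> x \<noteq> y \<Longrightarrow> 2 * e < dist x y"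
    and DH: "D \<subseteq> H"
  obtains x where "x \<in> S" "b \<in> closure (miss x e)"
proof (rule ccontr)
  assume "\<not> thesis"
  then have "\<forall>x\<in>S. b \<notin> closure (miss x e)"
    using that by blast
  then have "b \<in> (\<Inter>x\<in>S. - closure (miss x e))"
    by blast
  moreover have "open (\<Inter>x\<in>S. - closure (miss x e))"
    using S(1) by (intro open_INT) auto
  ultimately have "(\<Inter>x\<in>S. - closure (miss x e)) \<inter> D \<noteq> {}"
    using b D(1) open_Int_closure_eq_empty by blast
  then obtain h where h: "h \<in> D" "\<And>x. x \<in> S \<Longrightarrow> h \<notin> closure (miss x e)"
    by blast
  have "\<forall>x\<in>S. \<exists>y. y \<in> fiber h \<and> dist x y \<le> e"
  proof
    fix x assume "x \<in> S"
    then have "h \<notin> miss x e"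
      using h(2) closure_subset by blast
    then show "\<exists>y. y \<in> fiber h \<and> dist x y \<le> e"
      using h(1) DH by (auto simp: miss_def fiber_def)
  qed
  then obtain y where y: "\<And>x. x \<in> S \<Longrightarrow> y x \<in> fiber h" "\<And>x. x \<in> S \<Longrightarrow> dist x (y x) \<le> e"
    by metis
  have "inj_on y S"
  proof (rule inj_onI, rule ccontr)
    fix u v assume uv: "u \<in> S" "v \<in> S" "y u = y v" "u \<noteq> v"
    have "dist u v \<le> dist u (y u) + dist v (y v)"
      using uv(3) dist_triangle2[of u v "y u"] by simp
    then show False
      using y(2)[OF uv(1)] y(2)[OF uv(2)] sep[OF uv(1,2,4)] by simp
  qed
  then have "card S \<le> card (fiber h)"
    using y(1) D(2)[OF h(1)] by (intro card_inj_on_le[of y]) auto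
  then show False
    using S(2) D(2)[OF h(1)] by simp
qed

end

locale equicontinuous_factor = minimal_factor act X actH H \<pi> + H: equicontinuous_G_system actH H \<nu>
  for act :: "'g::group_add \<Rightarrow> 'x::metric_space \<Rightarrow> 'x" and X
    and actH :: "'g \<Rightarrow> 'h::metric_space \<Rightarrow> 'h" and H and \<pi> and \<nu> +
  fixes D :: "'h set" and K :: nat
  assumes tame: "tame_system act X"
    and K: "K > 0" and D: "D \<subseteq> H" "H \<subseteq> closure D"
    and fiber_D: "h \<in> D \<Longrightarrow> finite (fiber h) \<and> card (fiber h) = K"
begin

text \<open>Near such a point there are fibres that meet the ball of radius e and fibres that avoid
  even radius 2e; this is the set B of the independence argument.\<close>

definition ambiguous :: "'x \<Rightarrow> real \<Rightarrow> 'h set" where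
  "ambiguous q e = H \<inter> closure (hit q e) \<inter> closure (miss q (2 * e))"

lemma closedin_ambiguous: "closedin (top_of_set H) (ambiguous q e)"
  unfolding ambiguous_def Int_assoc by (intro closedin_closed_Int closed_Int) auto

lemma ambiguous_null:
  assumes "e > 0"
  shows "emeasure \<nu> (ambiguous q e) = 0"
proof (rule ccontr)
  assume "emeasure \<nu> (ambiguous q e) \<noteq> 0"
  then have pos: "H.prob (ambiguous q e) > 0"
    by (simp add: H.emeasure_eq_measure zero_less_measure_iff)
  define O' where "O' b = (if b then hit q e else miss q (2 * e))" for b
  have O: "openin (top_of_set H) (O' b)" for b
    by (simp add: O'_def openin_hit openin_miss)
  have "ambiguous q e \<subseteq> closure (O' b)" for b
    by (auto simp: O'_def ambiguous_def)
  then obtain g :: "nat \<Rightarrow> 'g" where g: "\<And>n \<sigma>. \<exists>h\<in>H. \<forall>i<n. actH (g i) h \<in> O' (\<sigma> i)"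
    using H.independent_sequence[of O' "ambiguous q e", OF O closedin_ambiguous _ pos] by blast
  show False
  proof (rule tame_no_independent_sequence[OF X.G_system tame])
    \<comment> \<open>The open ball in \<open>hit\<close> and the complement of the closed ball in
      \<open>miss\<close> are relaxed to closed sets; the gap between e and 2e keeps them
      disjoint.\<close>
    show "closed (cball q e)" "closed (- ball q (2 * e))" "cball q e \<inter> - ball q (2 * e) = {}"
      using \<open>e > 0\<close> by auto
    fix \<sigma> :: "nat \<Rightarrow> bool"
    have "\<exists>x :: nat \<Rightarrow> 'x. (\<forall>j. x j \<in> X) \<and>
        (\<forall>i<n. (\<sigma> i \<longrightarrow> (\<exists>j<K. act (g i) (x j) \<in> cball q e)) \<and>
          (\<not> \<sigma> i \<longrightarrow> (\<forall>j<K. act (g i) (x j) \<in> - ball q (2 * e))))" for n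
    proof -
      \<comment> \<open>A finite pattern is an open condition on h and D is dense, so h can be taken
        in D and its fibre listed as K points.\<close>
      let ?W = "{h \<in> H. \<forall>i<n. actH (g i) h \<in> O' (\<sigma> i)}"
      obtain V where V: "open V" "?W = H \<inter> V"
        using H.openin_finite_pattern[of O' n g \<sigma>, OF O] by (auto simp: openin_open)
      have "?W \<noteq> {}"
        using g[of n \<sigma>] by blast
      then have "V \<inter> closure D \<noteq> {}"
        using V(2) D(2) by blast
      then have "V \<inter> D \<noteq> {}"
        using V(1) by (metis open_Int_closure_eq_empty)
      then obtain h where h: "h \<in> D" "h \<in> ?W"
        using V(2) D(1) by blast
      obtain y where y: "bij_betw y {..<K} (fiber h)"
        using ex_bij_betw_nat_finite[of "fiber h"] fiber_D[OF h(1)] by (auto simp: atLeast0LessThan)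
      define x where "x j = y (if j < K then j else 0)" for j
      have x_fib: "x j \<in> fiber h" for j
        using y K unfolding x_def bij_betw_def by auto
      have x_onto: "\<exists>j<K. x j = w" if w: "w \<in> fiber h" for w
      proof -
        obtain j where "j < K" "w = y j"
          using y w unfolding bij_betw_def by blast
        then show ?thesis
          by (intro exI[of _ j]) (simp add: x_def)
      qed
      have "\<exists>j<K. act (g i) (x j) \<in> cball q e" if i: "i < n" "\<sigma> i" for i
      proof -
        have "actH (g i) h \<in> \<pi> ` (X \<inter> ball q e)"
        proof -
          have "actH (g i) h \<in> O' (\<sigma> i)"
            using h(2) i(1) by blast
          then show ?thesis
            using i(2) hit_subset by (auto simp: O'_def)
        qed
        then obtain z where z: "z \<in> X" "z \<in> ball q e" "\<pi> z = actH (g i) h"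
          by auto
        have "act (- g i) z \<in> fiber h"
          using z h(2) X.act_in H.act_uminus_act equivariant by (simp add: fiber_def)
        then obtain j where "j < K" "x j = act (- g i) z"
          using x_onto by blast
        then show ?thesis
          using z X.act_act_uminus by (intro exI[of _ j]) auto
      qed
      moreover have "act (g i) (x j) \<in> - ball q (2 * e)" if i: "i < n" "\<not> \<sigma> i" for i j
      proof -
        have "actH (g i) h \<notin> \<pi> ` (X \<inter> cball q (2 * e))"
        proof -
          have "actH (g i) h \<in> O' (\<sigma> i)"
            using h(2) i(1) by blast
          then show ?thesis
            using i(2) by (auto simp: O'_def miss_def)
        qed
        moreover have "actH (g i) h = \<pi> (act (g i) (x j))" "act (g i) (x j) \<in> X"
          using x_fib[of j] equivariant X.act_in by (auto simp: fiber_def)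
        ultimately have "act (g i) (x j) \<notin> cball q (2 * e)"
          by blast
        then show ?thesis
          by auto
      qed
      moreover have "\<forall>j. x j \<in> X"
        using x_fib by (simp add: fiber_def)
      ultimately show ?thesis
        by (intro exI[of _ x]) simp
    qed
    then obtain x :: "nat \<Rightarrow> 'x" where x: "\<forall>j. x j \<in> X"
      "\<forall>i. (\<sigma> i \<longrightarrow> (\<exists>j<K. act (g i) (x j) \<in> cball q e)) \<and>
          (\<not> \<sigma> i \<longrightarrow> (\<forall>j<K. act (g i) (x j) \<in> - ball q (2 * e)))"
      using finite_patterns_imp_infinite_pattern[of X "\<lambda>i. act (g i)" "cball q e" "- ball q (2 * e)" \<sigma> K]
        X.compact X.continuous_act by auto
    show "\<exists>F. finite F \<and> F \<subseteq> X \<and> (\<forall>n. (\<sigma> n \<longrightarrow> (\<exists>x\<in>F. act (g n) x \<in> cball q e)) \<and>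
        (\<not> \<sigma> n \<longrightarrow> (\<forall>x\<in>F. act (g n) x \<in> - ball q (2 * e))))"
      using x by (intro exI[of _ "x ` {..<K}"]) auto
  qed
qed

text \<open>The conclusion covers every q whose ball contains x, so that q can later be taken from a
  finite net of X. Only countably many ambiguous sets are then involved.\<close>

lemma large_fiber_ambiguous:
  assumes b: "b \<in> H" and large: "fiber_card_ge (Suc K) b"
  obtains x m where "x \<in> fiber b"
    "\<And>q. x \<in> ball q (inverse (Suc m)) \<Longrightarrow> b \<in> ambiguous q (inverse (Suc m))"
proof -
  obtain S where S: "S \<subseteq> fiber b" "finite S" "card S = Suc K"
    using fiber_card_ge_subset[OF large] by blast
  obtain c where c: "c > 0" "\<And>x y. x \<in> S \<Longrightarrow> y \<in> S \<Longrightarrow> x \<noteq> y \<Longrightarrow> c \<le> dist x y"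
    using finite_set_separation[OF S(2)] by blast
  \<comment> \<open>If q is within e of x, the ball of radius 2e around q lies in the ball of radius
    3e around x, and \<open>closure_miss\<close> requires 2 * (3 * e) < c; hence c/6.\<close>
  obtain m where m: "inverse (Suc m) < c / 6"
    using reals_Archimedean[of "c / 6"] c(1) by auto
  define e where "e = inverse (real (Suc m))"
  have e: "e > 0" "6 * e < c"
    using m by (simp_all add: e_def)
  obtain x where x: "x \<in> S" "b \<in> closure (miss x (3 * e))"
  proof (rule closure_miss[OF D(2) fiber_D b S(2) _ S(1) _ _ D(1)])
    show "K < card S" "0 < 3 * e"
      using S(3) e(1) by auto
    show "2 * (3 * e) < dist x y" if "x \<in> S" "y \<in> S" "x \<noteq> y" for x y
      using c(2)[OF that] e(2) by simp
  qed
  have xb: "x \<in> X" "\<pi> x = b"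
    using x(1) S(1) by (auto simp: fiber_def)
  show thesis
  proof (rule that)
    show "x \<in> fiber b"
      using x(1) S(1) by blast
    fix q assume "x \<in> ball q (inverse (Suc m))"
    then have q: "x \<in> ball q e"
      by (simp add: e_def)
    have "cball q (2 * e) \<subseteq> cball x (3 * e)"
    proof
      fix z assume "z \<in> cball q (2 * e)"
      then show "z \<in> cball x (3 * e)"
        using q dist_triangle[of x z q] by (simp add: dist_commute)
    qed
    then have "miss x (3 * e) \<subseteq> miss q (2 * e)"
      unfolding miss_def by blast
    then have "b \<in> closure (miss q (2 * e))"
      using x(2) closure_mono by blast
    then have "b \<in> ambiguous q e"
      using closure_hit[OF xb(1) q] xb(2) b by (simp add: ambiguous_def)
    then show "b \<in> ambiguous q (inverse (Suc m))"
      by (simp add: e_def)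
  qed
qed

text \<open>Finite nets at the scales 1/(m + 1) give a countable union of null sets containing all
  base points with large fibres. A subset of a null set need not be measurable, so measurability is
  derived separately from the closed sets \<open>separated\<close>.\<close>

lemma large_fibers_null: "{h \<in> H. fiber_card_ge (Suc K) h} \<in> null_sets \<nu>"
proof -
  have "\<exists>N. finite N \<and> N \<subseteq> X \<and> X \<subseteq> (\<Union>q\<in>N. ball q (inverse (Suc m)))" for m
    using seq_compact_imp_totally_bounded[OF compact_imp_seq_compact[OF X.compact]] by simp
  then obtain N where N: "\<And>m. finite (N m)" "\<And>m. X \<subseteq> (\<Union>q\<in>N m. ball q (inverse (Suc m)))"
    by metis
  define Z where "Z = (\<Union>m. \<Union>q\<in>N m. ambiguous q (inverse (Suc m)))"
  have "ambiguous q (inverse (Suc m)) \<in> null_sets \<nu>" for q m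
    by (intro null_setsI ambiguous_null H.sets_closedin closedin_ambiguous) simp
  then have "(\<Union>q\<in>N m. ambiguous q (inverse (Suc m))) \<in> null_sets \<nu>" for m
    by (rule null_sets_UN'[OF countable_finite[OF N(1)]])
  then have "Z \<in> null_sets \<nu>"
    unfolding Z_def by (rule null_sets_UN)
  moreover have "{h \<in> H. fiber_card_ge (Suc K) h} \<subseteq> Z"
  proof
    fix b assume "b \<in> {h \<in> H. fiber_card_ge (Suc K) h}"
    then have b: "b \<in> H" "fiber_card_ge (Suc K) b"
      by auto
    obtain x m where x: "x \<in> fiber b"
      "\<And>q. x \<in> ball q (inverse (Suc m)) \<Longrightarrow> b \<in> ambiguous q (inverse (Suc m))"
      by (rule large_fiber_ambiguous[OF b]) (rule that, assumption, blast)
    then have "x \<in> X"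
      by (simp add: fiber_def)
    then obtain q where "q \<in> N m" "x \<in> ball q (inverse (Suc m))"
      using N(2)[of m] by blast
    then show "b \<in> Z"
      using x(2) unfolding Z_def by blast
  qed
  moreover have "{h \<in> H. fiber_card_ge (Suc K) h} \<in> sets \<nu>"
  proof -
    have "{h \<in> H. fiber_card_ge (Suc K) h} = (\<Union>k. separated (Suc K) (inverse (Suc k)))"
    proof (intro subset_antisym subsetI)
      fix h assume "h \<in> (\<Union>k. separated (Suc K) (inverse (Suc k)))"
      then obtain k where "h \<in> separated (Suc K) (inverse (Suc k))"
        by blast
      then show "h \<in> {h \<in> H. fiber_card_ge (Suc K) h}"
        using separated_imp_fiber_card_ge separated_subset by fastforce
    next
      fix h assume "h \<in> {h \<in> H. fiber_card_ge (Suc K) h}"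
      then obtain k where "h \<in> separated (Suc K) (inverse (Suc k))"
        using fiber_card_ge_imp_separated[of "Suc K" h] by auto
      then show "h \<in> (\<Union>k. separated (Suc K) (inverse (Suc k)))"
        by blast
    qed
    then show ?thesis
      using H.sets_closedin[OF closedin_separated] by auto
  qed
  ultimately show ?thesis
    using null_sets_subset by blast
qed

end

theorem theorem1p4:
  fixes act :: "'g::group_add \<Rightarrow> 'x::metric_space \<Rightarrow> 'x"
    and X :: "'x set"
    and actH :: "'g \<Rightarrow> 'h::metric_space \<Rightarrow> 'h"
    and H :: "'h set"
    and \<pi> :: "'x \<Rightarrow> 'h"
    and \<nu> :: "'h measure"
    and K :: nat
  assumes "countable (UNIV :: 'g set)" and "infinite (UNIV :: 'g set)"
    and "G_system act X" and "minimal_system act X" and "tame_system act X"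
    and "max_equicontinuous_factor act X actH H \<pi>"
    and "haar_measure actH H \<nu>"
    and "K \<ge> 1"
    and "almost_K_to_one X H \<pi> K"
  shows "emeasure \<nu> {h\<in>H. fiber_card_eq X \<pi> h K} = 1"
proof -
  have \<pi>: "G_system actH H" "continuous_on X \<pi>" "\<pi> ` X = H"
    "\<And>g x. x \<in> X \<Longrightarrow> \<pi> (act g x) = actH g (\<pi> x)"
    using assms(6) unfolding max_equicontinuous_factor_def by auto
  have inv: "invariant_prob actH H \<nu>"
    using assms(7) unfolding haar_measure_def by blast
  have min: "minimal_system actH H"
    by (rule minimal_factor_system[OF assms(3,4) \<pi>(1-3)]) (rule \<pi>(4))
  interpret X: minimal_G_system act X
    by (rule minimal_G_system.intro[OF assms(3,4)])
  interpret H: minimal_G_system actH H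
    by (rule minimal_G_system.intro[OF \<pi>(1) min])
  interpret H: equicontinuous_G_system actH H \<nu>
    by unfold_locales (rule equicontinuous_max_factor[OF assms(3,6)], assumption, rule inv)
  interpret minimal_factor act X actH H \<pi>
    by unfold_locales (rule \<pi>(2) \<pi>(3) \<pi>(4) assms(1) H.nonempty, assumption?)+
  obtain D where dense: "D \<subseteq> {h \<in> H. fiber_card_eq X \<pi> h K}" "gdelta_in (top_of_set H) D" "H \<subseteq> closure D"
    using assms(9) unfolding almost_K_to_one_def residual_in_def by blast
  interpret equicontinuous_factor act X actH H \<pi> \<nu> D K
  proof unfold_locales
    show "tame_system act X" "H \<subseteq> closure D" "D \<subseteq> H" "0 < K"
      using assms(5,8) dense by auto
    show "finite (fiber h) \<and> card (fiber h) = K" if "h \<in> D" for h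
      using dense(1) that by (auto simp: fiber_card_eq_iff)
  qed
  have "{h \<in> H. fiber_card_eq X \<pi> h K} \<subseteq> {h \<in> H. fiber_card_ge K h}"
    by (auto simp: fiber_card_eq_iff fiber_card_ge_def)
  then have "D \<subseteq> {h \<in> H. fiber_card_ge K h}"
    using dense(1) by (rule order.trans[rotated])
  then have res: "residual_in H {h \<in> H. fiber_card_ge K h}"
    unfolding residual_in_def using dense(2,3) by (intro exI[of _ D] conjI)
  have ge: "fiber_card_ge K h" if "h \<in> H" for h
    by (rule residual_fiber_card_ge[OF res K that])
  \<comment> \<open>As no fibre has fewer than K points, the set in question is exactly the
    complement of the null set of large fibres.\<close>
  have "fiber_card_eq X \<pi> h K \<longleftrightarrow> \<not> fiber_card_ge (Suc K) h" if "h \<in> H" for h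
    using ge[OF that] by (auto simp: fiber_card_eq_iff fiber_card_ge_def)
  then have "{h \<in> H. fiber_card_eq X \<pi> h K} = space \<nu> - {h \<in> H. fiber_card_ge (Suc K) h}"
    by (auto simp: H.space_\<nu>)
  then have "emeasure \<nu> {h \<in> H. fiber_card_eq X \<pi> h K} = emeasure \<nu> (space \<nu>)"
    by (simp add: emeasure_Diff_null_set[OF large_fibers_null])
  then show ?thesis
    by (simp add: H.emeasure_space_1)
qed

end
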